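(* Let $\Omega\subset\mathbb{R}^2$ be a bounded polygonal domain with a quasi-uniform fine triangulation $\mathcal{T}_h$, a coarse triangulation $\mathcal{T}_H$, and the overlapping domain decomposition $\{\Omega_j'\}_{j=1}^{\mathcal{N}}$ with associated spaces $V_j$ and operators $R_j^T:V_j\to V$, $0\le j\le\mathcal{N}$, described in the context. Let $K$ be the stiffness matrix on $V$ of the standard finite element method and let $\bar K$ be the stiffness matrix on $V$ of either the edge-based smoothed finite element method (ES-FEM), $\bar K=\bar K_{\mathrm{ES}}$, or the strain-smoothed element method (SSE), $\bar K=\bar K_{\mathrm{SSE}}$. Define the original and the enhanced two-level additive Schwarz preconditioners $$M^{-1}=\sum_{j=0}^{\mathcal{N}}R_j^TK_j^{-1}R_j,\quad K_j=R_jKR_j^T,\qquad \bar M^{-1}=\sum_{j=0}^{\mathcal{N}}R_j^T\bar K_j^{-1}R_j,\quad \bar K_j=R_j\bar KR_j^T .$$ Then $$\kappa_{\mathrm{ASM}}(\bar M^{-1}\bar K)\le\kappa_{\mathrm{ASM}}(M^{-1}\bar K),$$ where $\kappa_{\mathrm{ASM}}$ denotes the additive Schwarz condition number defined in the context.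
   Context: Triangulations are conforming. $\mathcal{P}_n(\omega)$ is the set of polynomials of degree at most $n$ on $\omega$. $V=V_h=\{v\in H_0^1(\Omega): v|_e\in\mathcal{P}_1(e)\ \forall e\in\mathcal{T}_h\}$. Finite element functions are identified with their vectors of nodal degrees of freedom; $|\cdot|$ of a region denotes its area. Standard stiffness matrix: $u^TKv=\int_\Omega\nabla u\cdot\nabla v\,d\Omega$, $u,v\in V$. ES-FEM: each $e\in\mathcal{T}_h$ is divided into three triangles by joining its barycenter to its vertices, each corresponding to one edge of $e$. The smoothing domain of an edge of $\mathcal{T}_h$ is the union of the (one or two) sub-triangles corresponding to it. For $u\in V$, $\bar\nabla_{\mathrm{ES}}u$ is the piecewise constant field equal to $\frac{|e^{(1)}|\nabla u|_{e^{(1)}}+|e^{(2)}|\nabla u|_{e^{(2)}}}{|e^{(1)}|+|e^{(2)}|}$ on the smoothing domain of an edge shared by $e^{(1)},e^{(2)}$, and equal to $\nabla u|_e$ on the smoothing domain of a boundary edge of $e$. Then $u^T\bar K_{\mathrm{ES}}v=\int_\Omega\bar\nabla_{\mathrm{ES}}u\cdot\bar\nabla_{\mathrm{ES}}v\,d\Omega$. SSE: for $u\in V$, $e\in\mathcal{T}_h$, number the edges of $e$ by $k=1,2,3$ and let $e^{(k)}$ be the neighbor of $e$ across the $k$th edge. Set $\hat\epsilon^{(k)}=\frac{|e|\nabla u|_e+|e^{(k)}|\nabla u|_{e^{(k)}}}{|e|+|e^{(k)}|}$ if $e^{(k)}$ exists and $\hat\epsilon^{(k)}=\nabla u|_e$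 otherwise. On $e$, $\bar\nabla_{\mathrm{SSE}}u$ is the linear vector polynomial with values $\frac12(\hat\epsilon^{(k-1)}+\hat\epsilon^{(k)})$ (with $\hat\epsilon^{(0)}:=\hat\epsilon^{(3)}$) at the three Gaussian integration points $\mathrm{G}k$, $k=1,2,3$, of $e$ (the three-point rule with equal weights $|e|/3$, exact for quadratics). Then $u^T\bar K_{\mathrm{SSE}}v=\int_\Omega\bar\nabla_{\mathrm{SSE}}u\cdot\bar\nabla_{\mathrm{SSE}}v\,d\Omega=\sum_{e\in\mathcal{T}_h}\frac{|e|}{3}\sum_{k=1}^3\bar\nabla_{\mathrm{SSE}}u|_e(\mathrm{G}k)\cdot\bar\nabla_{\mathrm{SSE}}v|_e(\mathrm{G}k)$. The matrices $K$, $\bar K_{\mathrm{ES}}$, $\bar K_{\mathrm{SSE}}$ are symmetric positive definite on $V$. Domain decomposition: $\Omega$ is decomposed into nonoverlapping subdomains $\{\Omega_j\}_{j=1}^{\mathcal{N}}$, each the union of several elements of $\mathcal{T}_H$ (uniformly bounded in number). Each $\Omega_j$ is enlarged to a region $\Omega_j'\subset\Omega$ by adding layers of fine elements of $\mathcal{T}_h$ with overlap width $\delta$. For $1\le j\le\mathcal{N}$, $V_j=\{v_j\in H_0^1(\Omega_j'): v_j|_e\in\mathcal{P}_1(e)\ \forall e\in\mathcal{T}_h\text{ inside }\Omega_j'\}$, and $V_0=\{v_0\in H_0^1(\Omega): v_0|_e\in\mathcal{P}_1(e)\ \forall e\in\mathcal{T}_H\}$. $R_j^T:V_j\to V$, $0\le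 j\le\mathcal{N}$, is the natural interpolation operator (extension by zero for $j\ge1$; nodal interpolation of coarse functions, which is inclusion when $\mathcal{T}_h$ refines $\mathcal{T}_H$, for $j=0$), $R_j$ is its transpose, and $V=\sum_{j=0}^{\mathcal{N}}R_j^TV_j$. The local matrices $K_j$, $\bar K_j$ are symmetric positive definite. Additive Schwarz condition number: for a symmetric positive definite $A:V\to V$ and a preconditioner $M^{-1}=\sum_{j=0}^{\mathcal{N}}R_j^T\tilde A_j^{-1}R_j$ with symmetric positive definite local operators $\tilde A_j:V_j\to V_j$, set $\kappa_{\mathrm{ASM}}(M^{-1}A)=\omega_0C_0^2/\tau_0$, where: $C_0>0$ is the minimum constant such that every $v\in V$ has a decomposition $v=\sum_jR_j^Tv_j$, $v_j\in V_j$, with $\sum_jv_j^T\tilde A_jv_j\le C_0^2\,v^TAv$; $\tau_0>0$ is the maximum constant such that for all $v_j\in V_j$ and all $\tau\in(0,\tau_0]$, $\big(\sum_jR_j^Tv_j\big)^TA\big(\sum_jR_j^Tv_j\big)\le\frac1\tau\sum_j(R_j^Tv_j)^TA(R_j^Tv_j)$; $\omega_0>0$ is the minimum constant such that $(R_j^Tv_j)^TA(R_j^Tv_j)\le\omega_0\,v_j^T\tilde A_jv_j$ for all $j$ and all $v_j\in V_j$. Here $A=\bar K$, with $\tilde A_j=K_j$ for $M^{-1}$ and $\tilde A_j=\bar K_j$ for $\bar M^{-1}$. *)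

theory Defs
  imports "HOL-Analysis.Analysis"
begin

type_synonym point = "real^2"
type_synonym scalar_fn = "point \<Rightarrow> real"
type_synonym form = "scalar_fn \<Rightarrow> scalar_fn \<Rightarrow> real"

section \<open>Domains and triangulations\<close>

text \<open>The condition \<^term>\<open>interior (closure \<Omega>) = \<Omega>\<close> excludes slits and punctures.\<close>

definition polygonal_domain :: "point set \<Rightarrow> bool" where
  "polygonal_domain \<Omega> \<longleftrightarrow>
     open \<Omega> \<and> connected \<Omega> \<and> \<Omega> \<noteq> {} \<and> interior (closure \<Omega>) = \<Omega> \<and>
     (\<exists>S. finite S \<and> frontier \<Omega> = (\<Union>(a, b)\<in>S. closed_segment a b))"

text \<open>Elements are closed triangles; \<^const>\<open>triangulation\<close> is the conformity condition that two
  elements meet in a common face.\<close>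

definition triangulation_of :: "point set set \<Rightarrow> point set \<Rightarrow> bool" where
  "triangulation_of T \<Omega> \<longleftrightarrow>
     triangulation T \<and> (\<forall>e\<in>T. 2 simplex e) \<and> \<Union>T = closure \<Omega>"

definition mesh_size :: "point set set \<Rightarrow> real" where
  "mesh_size T = Max (diameter ` T)"

definition quasi_uniform :: "real \<Rightarrow> point set set \<Rightarrow> bool" where
  "quasi_uniform c T \<longleftrightarrow> (\<forall>e\<in>T. \<exists>x. ball x (c * mesh_size T) \<subseteq> e)"

definition vertices :: "point set \<Rightarrow> point set" where
  "vertices e = {p. p extreme_point_of e}"

definition nodes :: "point set set \<Rightarrow> point set" where
  "nodes T = (\<Union>e\<in>T. vertices e)"

definition edges :: "point set set \<Rightarrow> point set set" where
  "edges T = {f. \<exists>e\<in>T. f edge_of e}"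

definition barycenter :: "point set \<Rightarrow> point" where
  "barycenter e = (\<Sum>p\<in>vertices e. p) /\<^sub>R 3"

abbreviation area :: "point set \<Rightarrow> real" where
  "area S \<equiv> measure lebesgue S"


section \<open>The Sobolev space with zero boundary values\<close>

definition grad :: "scalar_fn \<Rightarrow> point \<Rightarrow> point" where
  "grad u x = (THE g. GDERIV u x :> g)"

primrec C_k :: "nat \<Rightarrow> scalar_fn \<Rightarrow> bool" where
  "C_k 0 f \<longleftrightarrow> continuous_on UNIV f"
| "C_k (Suc k) f \<longleftrightarrow>
     (\<exists>g. (\<forall>x. GDERIV f x :> g x) \<and> (\<forall>i. C_k k (\<lambda>x. g x $ i)))"

definition test_functions :: "point set \<Rightarrow> scalar_fn set" where
  "test_functions U =
     {f. (\<forall>k. C_k k f) \<and> (\<exists>S. compact S \<and> S \<subseteq> U \<and> (\<forall>x. x \<notin> S \<longrightarrow> f x = 0))}"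

text \<open>Closure of the test functions in the norm of \<open>H\<^sup>1(U)\<close>; the limit \<open>g\<close> of the gradients is the
  weak gradient of \<open>v\<close>.\<close>

definition H1_0 :: "point set \<Rightarrow> scalar_fn set" where
  "H1_0 U = {v. v \<in> borel_measurable (lebesgue_on U) \<and>
     (\<exists>g f. g \<in> borel_measurable (lebesgue_on U) \<and>
        (\<forall>n::nat. f n \<in> test_functions U) \<and>
        (\<lambda>n. \<integral>\<^sup>+x. ennreal ((f n x - v x)\<^sup>2) \<partial>lebesgue_on U) \<longlonglongrightarrow> 0 \<and>
        (\<lambda>n. \<integral>\<^sup>+x. ennreal ((norm (grad (f n) x - g x))\<^sup>2) \<partial>lebesgue_on U) \<longlonglongrightarrow> 0)}"


section \<open>Finite element spaces\<close>

definition P1 :: "point set \<Rightarrow> scalar_fn set" where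
  "P1 e = {f. \<exists>a c. \<forall>x\<in>e. f x = a \<bullet> x + c}"

text \<open>A class of \<^term>\<open>H1_0 U\<close> that is affine on the elements has exactly one representative that
  is affine on every closed element in the closure of \<open>U\<close> and vanishes off \<open>U\<close> (the continuous
  one, extended by zero).  Members of the space are these representatives, so point evaluation at
  nodes makes sense and equality is equality of functions.\<close>

definition fe_space :: "point set set \<Rightarrow> point set \<Rightarrow> scalar_fn set" where
  "fe_space T U =
     {v \<in> H1_0 U. (\<forall>e\<in>T. e \<subseteq> closure U \<longrightarrow> v \<in> P1 e) \<and> (\<forall>x. x \<notin> U \<longrightarrow> v x = 0)}"

definition nodal_interpolant :: "point set set \<Rightarrow> scalar_fn \<Rightarrow> scalar_fn" where
  "nodal_interpolant T w =
     (THE v. (\<forall>e\<in>T. v \<in> P1 e) \<and> (\<forall>p\<in>nodes T. v p = w p) \<and> (\<forall>x. x \<notin> \<Union>T \<longrightarrow> v x = 0))"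

definition extension_by_zero :: "point set \<Rightarrow> scalar_fn \<Rightarrow> scalar_fn" where
  "extension_by_zero U v = (\<lambda>x. if x \<in> U then v x else 0)"

text \<open>The constant value of the gradient on the element \<open>e\<close>.\<close>

definition element_grad :: "scalar_fn \<Rightarrow> point set \<Rightarrow> point" where
  "element_grad u e = (THE g. \<forall>x\<in>interior e. GDERIV u x :> g)"


section \<open>Stiffness matrices\<close>

text \<open>Finite element functions are identified with their nodal vectors; a matrix \<open>B\<close> is represented
  by the bilinear form \<open>u\<^sup>T B v\<close>.\<close>

definition stiffness :: "point set \<Rightarrow> form" where
  "stiffness \<Omega> u v = (LINT x:\<Omega>|lebesgue. grad u x \<bullet> grad v x)"

text \<open>Area-weighted average over the elements having \<open>f\<close> as an edge: two of them for an interior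
  edge; for a boundary edge there is only one and the value is the gradient on that element.\<close>

definition smoothed_grad :: "point set set \<Rightarrow> scalar_fn \<Rightarrow> point set \<Rightarrow> point" where
  "smoothed_grad T u f =
     (\<Sum>e | e \<in> T \<and> f edge_of e. area e *\<^sub>R element_grad u e) /\<^sub>R
     (\<Sum>e | e \<in> T \<and> f edge_of e. area e)"

definition smoothing_domain :: "point set set \<Rightarrow> point set \<Rightarrow> point set" where
  "smoothing_domain T f =
     (\<Union>e\<in>{e\<in>T. f edge_of e}. convex hull (insert (barycenter e) f))"

text \<open>Piecewise fields are written as sums over the interiors of the pieces, which are pairwise
  disjoint and cover the domain up to a null set.\<close>

definition ES_grad :: "point set set \<Rightarrow> scalar_fn \<Rightarrow> point \<Rightarrow> point" where
  "ES_grad T u x =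
     (\<Sum>f\<in>edges T. indicator (interior (smoothing_domain T f)) x *\<^sub>R smoothed_grad T u f)"

definition stiffness_ES :: "point set \<Rightarrow> point set set \<Rightarrow> form" where
  "stiffness_ES \<Omega> T u v = (LINT x:\<Omega>|lebesgue. ES_grad T u x \<bullet> ES_grad T v x)"

definition edge_numbering :: "point set set \<Rightarrow> (point set \<Rightarrow> nat \<Rightarrow> point set) \<Rightarrow> bool" where
  "edge_numbering T ed \<longleftrightarrow> (\<forall>e\<in>T. bij_betw (ed e) {1,2,3} {f. f edge_of e})"

text \<open>The quadrature rule with three equal weights, exact for all quadratic polynomials.\<close>

definition gauss_points :: "point set set \<Rightarrow> (point set \<Rightarrow> nat \<Rightarrow> point) \<Rightarrow> bool" where
  "gauss_points T G \<longleftrightarrow>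
     (\<forall>e\<in>T. (\<forall>k\<in>{1,2,3}. G e k \<in> e) \<and>
        (\<forall>(A::real^2^2) b c.
           let q = (\<lambda>x. x \<bullet> (A *v x) + b \<bullet> x + c)
           in (LINT x:e|lebesgue. q x) = area e / 3 * (\<Sum>k\<in>{1,2,3}. q (G e k))))"

definition linear_vector_polynomial :: "(point \<Rightarrow> point) \<Rightarrow> bool" where
  "linear_vector_polynomial p \<longleftrightarrow> (\<exists>(B::real^2^2) b. p = (\<lambda>x. B *v x + b))"

text \<open>On an element with neighbour across its edge \<open>f\<close>, the strain \<open>\<epsilon>\<close> attached to \<open>f\<close> is
  \<^term>\<open>smoothed_grad T u f\<close>; the index \<open>0\<close> is read as \<open>3\<close>.\<close>

definition SSE_poly ::
  "point set set \<Rightarrow> (point set \<Rightarrow> nat \<Rightarrow> point set) \<Rightarrow> (point set \<Rightarrow> nat \<Rightarrow> point) \<Rightarrow>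
   scalar_fn \<Rightarrow> point set \<Rightarrow> point \<Rightarrow> point" where
  "SSE_poly T ed G u e =
     (THE p. linear_vector_polynomial p \<and>
        (\<forall>k\<in>{1,2,3}. p (G e k) =
           (1/2) *\<^sub>R (smoothed_grad T u (ed e (if k = 1 then 3 else k - 1)) +
                    smoothed_grad T u (ed e k))))"

definition SSE_grad ::
  "point set set \<Rightarrow> (point set \<Rightarrow> nat \<Rightarrow> point set) \<Rightarrow> (point set \<Rightarrow> nat \<Rightarrow> point) \<Rightarrow>
   scalar_fn \<Rightarrow> point \<Rightarrow> point" where
  "SSE_grad T ed G u x = (\<Sum>e\<in>T. indicator (interior e) x *\<^sub>R SSE_poly T ed G u e x)"

definition stiffness_SSE ::
  "point set \<Rightarrow> point set set \<Rightarrow> (point set \<Rightarrow> nat \<Rightarrow> point set) \<Rightarrow>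
   (point set \<Rightarrow> nat \<Rightarrow> point) \<Rightarrow> form" where
  "stiffness_SSE \<Omega> T ed G u v =
     (LINT x:\<Omega>|lebesgue. SSE_grad T ed G u x \<bullet> SSE_grad T ed G v x)"


section \<open>Additive Schwarz preconditioners\<close>

text \<open>The data of \<open>M\<^sup>-\<^sup>1 = \<Sum>\<^sub>j R\<^sub>j\<^sup>T A\<^sub>j\<^sup>-\<^sup>1 R\<^sub>j\<close>: index set, spaces \<open>V\<^sub>j\<close>, prolongations \<open>R\<^sub>j\<^sup>T\<close>, and
  local operators \<open>A\<^sub>j\<close> as bilinear forms on \<open>V\<^sub>j\<close>.  The Schwarz condition number
  depends on these data, not only on their sum.\<close>

record schwarz =
  indices :: "nat set"
  local_space :: "nat \<Rightarrow> scalar_fn set"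
  prolong :: "nat \<Rightarrow> scalar_fn \<Rightarrow> scalar_fn"
  local_form :: "nat \<Rightarrow> form"

definition local_families :: "schwarz \<Rightarrow> (nat \<Rightarrow> scalar_fn) set" where
  "local_families M = {w. \<forall>j\<in>indices M. w j \<in> local_space M j}"

definition assemble :: "schwarz \<Rightarrow> (nat \<Rightarrow> scalar_fn) \<Rightarrow> scalar_fn" where
  "assemble M w = (\<lambda>x. \<Sum>j\<in>indices M. prolong M j (w j) x)"

definition spd_on :: "scalar_fn set \<Rightarrow> form \<Rightarrow> bool" where
  "spd_on V B \<longleftrightarrow>
     (\<forall>u\<in>V. \<forall>v\<in>V. B u v = B v u) \<and> (\<forall>v\<in>V. v \<noteq> (\<lambda>_. 0) \<longrightarrow> B v v > 0)"

text \<open>The standing requirements under which the Schwarz condition number is considered.\<close>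

definition schwarz_admissible :: "scalar_fn set \<Rightarrow> form \<Rightarrow> schwarz \<Rightarrow> bool" where
  "schwarz_admissible V A M \<longleftrightarrow>
     spd_on V A \<and> (\<forall>j\<in>indices M. spd_on (local_space M j) (local_form M j)) \<and>
     V = assemble M ` local_families M"

definition C_0 :: "scalar_fn set \<Rightarrow> form \<Rightarrow> schwarz \<Rightarrow> real" where
  "C_0 V A M = (LEAST C. C > 0 \<and>
     (\<forall>v\<in>V. \<exists>w\<in>local_families M. v = assemble M w \<and>
        (\<Sum>j\<in>indices M. local_form M j (w j) (w j)) \<le> C\<^sup>2 * A v v))"

definition tau_0 :: "form \<Rightarrow> schwarz \<Rightarrow> real" where
  "tau_0 A M = (GREATEST t\<^sub>0. t\<^sub>0 > 0 \<and>
     (\<forall>w\<in>local_families M. \<forall>t\<in>{0<..t\<^sub>0}.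
        A (assemble M w) (assemble M w) \<le>
        1 / t * (\<Sum>j\<in>indices M. A (prolong M j (w j)) (prolong M j (w j)))))"

definition omega_0 :: "form \<Rightarrow> schwarz \<Rightarrow> real" where
  "omega_0 A M = (LEAST \<omega>. \<omega> > 0 \<and>
     (\<forall>j\<in>indices M. \<forall>w\<in>local_space M j.
        A (prolong M j w) (prolong M j w) \<le> \<omega> * local_form M j w w))"

definition kappa_ASM :: "scalar_fn set \<Rightarrow> form \<Rightarrow> schwarz \<Rightarrow> real" where
  "kappa_ASM V A M = omega_0 A M * (C_0 V A M)\<^sup>2 / tau_0 A M"


section \<open>The overlapping two-level method\<close>

text \<open>\<open>\<Omega>s j\<close> and \<open>\<Omega>s' j\<close>, \<open>1 \<le> j \<le> N\<close>, are the (open) subdomains and their enlargements; \<open>m\<close>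
  bounds the number of coarse elements per subdomain, and \<open>\<delta>\<close> is the overlap width: the enlargement
  contains every point of \<open>\<Omega>\<close> closer than \<open>\<delta>\<close> to the subdomain.\<close>

definition overlapping_decomposition ::
  "point set \<Rightarrow> point set set \<Rightarrow> point set set \<Rightarrow> nat \<Rightarrow> nat \<Rightarrow> real \<Rightarrow>
   (nat \<Rightarrow> point set) \<Rightarrow> (nat \<Rightarrow> point set) \<Rightarrow> bool" where
  "overlapping_decomposition \<Omega> Th TH N m \<delta> \<Omega>s \<Omega>s' \<longleftrightarrow>
     (\<exists>S. (\<forall>j\<in>{1..N}. S j \<noteq> {} \<and> card (S j) \<le> m \<and> \<Omega>s j = interior (\<Union>(S j))) \<and>
          disjoint_family_on S {1..N} \<and> (\<Union>j\<in>{1..N}. S j) = TH) \<and>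
     \<delta> > 0 \<and>
     (\<forall>j\<in>{1..N}. (\<exists>E\<subseteq>Th. \<Omega>s' j = interior (\<Union>E)) \<and>
        \<Omega>s j \<subseteq> \<Omega>s' j \<and> \<Omega>s' j \<subseteq> \<Omega> \<and>
        {x\<in>\<Omega>. infdist x (\<Omega>s j) < \<delta>} \<subseteq> \<Omega>s' j)"

definition dd_space ::
  "point set \<Rightarrow> point set set \<Rightarrow> point set set \<Rightarrow> (nat \<Rightarrow> point set) \<Rightarrow> nat \<Rightarrow> scalar_fn set" where
  "dd_space \<Omega> Th TH \<Omega>s' j = (if j = 0 then fe_space TH \<Omega> else fe_space Th (\<Omega>s' j))"

definition dd_prolong ::
  "point set set \<Rightarrow> (nat \<Rightarrow> point set) \<Rightarrow> nat \<Rightarrow> scalar_fn \<Rightarrow> scalar_fn" where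
  "dd_prolong Th \<Omega>s' j =
     (if j = 0 then nodal_interpolant Th else extension_by_zero (\<Omega>s' j))"

text \<open>The local form is that of the matrix \<open>R\<^sub>j B R\<^sub>j\<^sup>T\<close>.\<close>

definition two_level_schwarz ::
  "point set \<Rightarrow> point set set \<Rightarrow> point set set \<Rightarrow> nat \<Rightarrow> (nat \<Rightarrow> point set) \<Rightarrow> form \<Rightarrow> schwarz" where
  "two_level_schwarz \<Omega> Th TH N \<Omega>s' B =
     \<lparr>indices = {0..N},
      local_space = dd_space \<Omega> Th TH \<Omega>s',
      prolong = dd_prolong Th \<Omega>s',
      local_form = (\<lambda>j u v. B (dd_prolong Th \<Omega>s' j u) (dd_prolong Th \<Omega>s' j v))\<rparr>"

end

theory Submission
  imports Defs "HOL-Library.Function_Algebras"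
begin

text \<open>With the exact local solvers \<open>R\<^sub>j Kbar R\<^sub>j\<^sup>T\<close> one has \<open>\<omega>\<^sub>0 = 1\<close>, while \<open>\<tau>\<^sub>0\<close> does not depend on the
  local solvers.  A decomposition of \<open>v\<close> that is stable for \<open>M\<close> with constant \<open>C\<^sub>0\<^sup>2\<close> is stable for
  \<open>Mbar\<close> with constant \<open>\<omega>\<^sub>0 C\<^sub>0\<^sup>2\<close>, because \<open>Kbar(R\<^sub>j\<^sup>T v\<^sub>j, R\<^sub>j\<^sup>T v\<^sub>j) \<le> \<omega>\<^sub>0 K(R\<^sub>j\<^sup>T v\<^sub>j, R\<^sub>j\<^sup>T v\<^sub>j)\<close>.  No
  comparison of \<open>Kbar\<close> with \<open>K\<close> is needed.  The extremal constants are attained since all spaces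
  are finite-dimensional, and the three stiffness forms are bilinear on \<open>V\<close>, being integrals of
  products of piecewise smooth fields that depend linearly on the function.\<close>

section \<open>Forms on finite-dimensional spaces\<close>

text \<open>\<open>C_0\<close>, \<open>tau_0\<close> and \<open>omega_0\<close> are a
  \<open>LEAST\<close> or a \<open>GREATEST\<close> over the reals, so an inequality between them
  has no content until the extremum is shown to exist. Admissibility supplies symmetry, positivity
  and the surjectivity of \<open>assemble\<close>, but neither bilinearity nor finite dimension;
  both have to come from the mesh. The delicate constant is \<open>C_0\<close>: its condition
  contains an existential quantifier over decompositions, so the set of valid constants is not
  visibly closed. Choosing for each v a decomposition of least energy removes the quantifier. After
  that the square of \<open>C_0\<close>, \<open>omega_0\<close> and the reciprocal of
  \<open>tau_0\<close> are all best constants r in a family of inequalities q i \<le> r * p i, and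
  one lemma, \<open>least_ratio\<close>, treats the three of them. If V = {0}, every positive number
  satisfies each of the three conditions and no extremum exists, so this case is argued
  separately.\<close>

instantiation "fun" :: (type, real_vector) real_vector
begin
text \<open>The pointwise structure applies twice, to scalar functions and to families of them
  indexed by \<open>nat\<close>. Thus the same lemmas serve V and the space of
  decompositions.\<close>

definition scaleR_fun_def: "r *\<^sub>R f = (\<lambda>x. r *\<^sub>R f x)"
instance
  by standard (simp_all add: scaleR_fun_def fun_eq_iff scaleR_add_right scaleR_add_left)
end

lemma scaleR_fun_apply [simp]: "(r *\<^sub>R f) x = r *\<^sub>R f x"
  by (simp add: scaleR_fun_def)

lemma sum_fun_apply: "(\<Sum>i\<in>I. f i) x = (\<Sum>i\<in>I. f i x)"
  by (induction I rule: infinite_finite_induct) auto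

text \<open>The library's \<open>linear\<close> asks for linearity on a whole type. Gradients taken
  by \<open>THE\<close> are unspecified at functions that are not differentiable, so
  \<open>element_grad\<close> can be handled as a linear map only on a carrier such as
  \<open>P1 e\<close>.\<close>

definition linear_on :: "'a::real_vector set \<Rightarrow> ('a \<Rightarrow> 'b::real_vector) \<Rightarrow> bool" where
  "linear_on X f \<longleftrightarrow>
     (\<forall>x\<in>X. \<forall>y\<in>X. f (x + y) = f x + f y) \<and> (\<forall>x\<in>X. \<forall>r. f (r *\<^sub>R x) = r *\<^sub>R f x)"

lemma linear_on_0:
  assumes "linear_on X f" "subspace X" shows "f 0 = 0"
proof -
  have "f (0 *\<^sub>R 0) = 0 *\<^sub>R f 0"
    using assms subspace_0[of X] unfolding linear_on_def by blast
  then show ?thesis by simp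
qed

lemma linear_on_diff:
  assumes "linear_on X f" "subspace X" "x \<in> X" "y \<in> X" shows "f (x - y) = f x - f y"
proof -
  have "f (x + (-1) *\<^sub>R y) = f x + (-1) *\<^sub>R f y"
    using assms subspace_scale[of X y "-1"] unfolding linear_on_def by metis
  then show ?thesis by simp
qed

lemma linear_on_sum:
  assumes "linear_on X f" "subspace X" "\<And>i. i \<in> I \<Longrightarrow> x i \<in> X"
  shows "f (\<Sum>i\<in>I. c i *\<^sub>R x i) = (\<Sum>i\<in>I. c i *\<^sub>R f (x i))"
  using assms(3)
proof (induction I rule: infinite_finite_induct)
  case (insert i I)
  have "(\<Sum>i\<in>I. c i *\<^sub>R x i) \<in> X" "c i *\<^sub>R x i \<in> X"
    using insert assms by (auto intro!: subspace_sum subspace_scale)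
  then show ?case
    using insert assms(1) by (auto simp: linear_on_def)
qed (auto simp: linear_on_0[OF assms(1,2)])

text \<open>A form of finite-dimensionality: for finite element spaces the functionals are the point
  evaluations at the nodes.\<close>

definition separated :: "'a::real_vector set \<Rightarrow> bool" where
  "separated X \<longleftrightarrow> (\<exists>P. finite P \<and> (\<forall>f\<in>P. linear (f :: 'a \<Rightarrow> real)) \<and>
     (\<forall>x\<in>X. (\<forall>f\<in>P. f x = 0) \<longrightarrow> x = 0))"

lemma separated_mono: "separated Y \<Longrightarrow> X \<subseteq> Y \<Longrightarrow> separated X"
  unfolding separated_def by blast

text \<open>Bilinearity on a subspace is what \<open>spd_on\<close> does not contain. Definiteness
  is split off into \<open>inner_form\<close>, because \<open>pullback\<close> need not preserve
  it.\<close>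

locale symmetric_form =
  fixes X :: "'a::real_vector set" and b :: "'a \<Rightarrow> 'a \<Rightarrow> real"
  assumes subspace: "subspace X"
    and sym: "x \<in> X \<Longrightarrow> y \<in> X \<Longrightarrow> b x y = b y x"
    and add_left: "x \<in> X \<Longrightarrow> y \<in> X \<Longrightarrow> z \<in> X \<Longrightarrow> b (x + y) z = b x z + b y z"
    and scale_left: "x \<in> X \<Longrightarrow> z \<in> X \<Longrightarrow> b (r *\<^sub>R x) z = r * b x z"
begin

lemma linear_on_left: "z \<in> X \<Longrightarrow> linear_on X (\<lambda>x. b x z)"
  by (simp add: linear_on_def add_left scale_left)

lemma add_right: "x \<in> X \<Longrightarrow> y \<in> X \<Longrightarrow> z \<in> X \<Longrightarrow> b z (x + y) = b z x + b z y"
  by (metis add_left subspace subspace_add sym)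

lemma scale_right: "x \<in> X \<Longrightarrow> z \<in> X \<Longrightarrow> b z (r *\<^sub>R x) = r * b z x"
  by (metis scale_left subspace subspace_scale sym)

lemma linear_on_right: "z \<in> X \<Longrightarrow> linear_on X (b z)"
  by (simp add: linear_on_def add_right scale_right)

lemma zero_left [simp]: "z \<in> X \<Longrightarrow> b 0 z = 0"
  using linear_on_0[OF linear_on_left subspace] by simp

lemma diff_left: "x \<in> X \<Longrightarrow> y \<in> X \<Longrightarrow> z \<in> X \<Longrightarrow> b (x - y) z = b x z - b y z"
  using linear_on_diff[OF linear_on_left subspace] by simp

lemma diff_right: "x \<in> X \<Longrightarrow> y \<in> X \<Longrightarrow> z \<in> X \<Longrightarrow> b z (x - y) = b z x - b z y"
  using linear_on_diff[OF linear_on_right subspace] by simp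

lemma sum_left:
  "(\<And>i. i \<in> I \<Longrightarrow> x i \<in> X) \<Longrightarrow> z \<in> X \<Longrightarrow> b (\<Sum>i\<in>I. c i *\<^sub>R x i) z = (\<Sum>i\<in>I. c i * b (x i) z)"
  by (rule linear_on_sum[OF linear_on_left subspace, unfolded real_scaleR_def])

lemma sum_right:
  "(\<And>i. i \<in> I \<Longrightarrow> x i \<in> X) \<Longrightarrow> z \<in> X \<Longrightarrow> b z (\<Sum>i\<in>I. c i *\<^sub>R x i) = (\<Sum>i\<in>I. c i * b z (x i))"
  by (rule linear_on_sum[OF linear_on_right subspace, unfolded real_scaleR_def])

lemma pullback:
  assumes "subspace Y" "linear_on Y f" "f ` Y \<subseteq> X"
  shows "symmetric_form Y (\<lambda>u v. b (f u) (f v))"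
proof
  have mem: "f y \<in> X" if "y \<in> Y" for y using assms(3) that by blast
  show "b (f x) (f y) = b (f y) (f x)" if "x \<in> Y" "y \<in> Y" for x y
    using that mem sym by blast
  show "b (f (x + y)) (f z) = b (f x) (f z) + b (f y) (f z)" if "x \<in> Y" "y \<in> Y" "z \<in> Y" for x y z
    using that mem add_left assms(2) by (simp add: linear_on_def)
  show "b (f (r *\<^sub>R x)) (f z) = r * b (f x) (f z)" if "x \<in> Y" "z \<in> Y" for x z r
    using that mem scale_left assms(2) by (simp add: linear_on_def)
qed (fact assms(1))

end

locale inner_form = symmetric_form +
  assumes pos: "x \<in> X \<Longrightarrow> x \<noteq> 0 \<Longrightarrow> 0 < b x x"
begin

lemma nonneg: "x \<in> X \<Longrightarrow> 0 \<le> b x x"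
  using pos[of x] by (cases "x = 0") auto

lemma inner_form_subset: "subspace Y \<Longrightarrow> Y \<subseteq> X \<Longrightarrow> inner_form Y b"
  by unfold_locales (auto simp: sym add_left scale_left pos subset_iff)

text \<open>Expand the nonnegative numbers \<open>b (x i - x j) (x i - x j)\<close>.\<close>

lemma sum_energy_le:
  assumes "finite I" "\<And>i. i \<in> I \<Longrightarrow> x i \<in> X"
  shows "b (\<Sum>i\<in>I. x i) (\<Sum>i\<in>I. x i) \<le> card I * (\<Sum>i\<in>I. b (x i) (x i))"
proof -
  have S: "(\<Sum>i\<in>I. x i) \<in> X" using assms subspace by (auto intro: subspace_sum)
  have "b (\<Sum>i\<in>I. x i) (\<Sum>i\<in>I. x i) = (\<Sum>i\<in>I. b (x i) (\<Sum>j\<in>I. x j))"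
    using sum_left[OF assms(2) S, of I "\<lambda>i. i" "\<lambda>_. 1"] by simp
  also have "\<dots> = (\<Sum>i\<in>I. \<Sum>j\<in>I. b (x i) (x j))"
    using sum_right[OF assms(2) assms(2), of I "\<lambda>i. i" _ "\<lambda>_. 1"] by simp
  also have "\<dots> \<le> (\<Sum>i\<in>I. \<Sum>j\<in>I. (b (x i) (x i) + b (x j) (x j)) / 2)"
  proof (intro sum_mono)
    fix i j assume "i \<in> I" "j \<in> I"
    then have m: "x i \<in> X" "x j \<in> X" "x i - x j \<in> X"
      using assms subspace by (auto intro: subspace_diff)
    have "0 \<le> b (x i - x j) (x i - x j)" using nonneg m by blast
    also have "\<dots> = b (x i) (x i) - 2 * b (x i) (x j) + b (x j) (x j)"
      using m by (simp add: diff_left diff_right sym[of "x j" "x i"])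
    finally show "b (x i) (x j) \<le> (b (x i) (x i) + b (x j) (x j)) / 2" by simp
  qed
  also have "\<dots> = card I * (\<Sum>i\<in>I. b (x i) (x i))"
    by (simp add: sum.distrib add_divide_distrib sum_divide_distrib[symmetric] sum_distrib_left[symmetric])
  finally show ?thesis .
qed

end

section \<open>Orthonormal bases and their consequences\<close>

definition orthonormal_basis :: "'a::real_vector set \<Rightarrow> ('a \<Rightarrow> 'a \<Rightarrow> real) \<Rightarrow> 'a set \<Rightarrow> bool" where
  "orthonormal_basis X b E \<longleftrightarrow> finite E \<and> E \<subseteq> X \<and>
     (\<forall>e\<in>E. \<forall>f\<in>E. b e f = (if e = f then 1 else 0)) \<and> (\<forall>x\<in>X. x = (\<Sum>e\<in>E. b x e *\<^sub>R e))"

text \<open>Induction on the number of separating functionals: the kernel of one of them has codimension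
  at most one, so at most one Gram-Schmidt step is needed.\<close>

lemma orthonormal_basis_exists_aux:
  assumes "finite P"
  shows "inner_form X b \<Longrightarrow> (\<forall>f\<in>P. linear (f :: 'a \<Rightarrow> real)) \<Longrightarrow>
     (\<forall>x\<in>X. (\<forall>f\<in>P. f x = 0) \<longrightarrow> x = 0) \<Longrightarrow> \<exists>E. orthonormal_basis (X :: 'a::real_vector set) b E"
  using assms
proof (induction P arbitrary: X)
  case empty
  then show ?case by (intro exI[of _ "{}"]) (auto simp: orthonormal_basis_def)
next
  case (insert f P)
  interpret inner_form X b by fact
  define X0 where "X0 = {x\<in>X. f x = 0}"
  have lf: "linear f" using insert by auto
  have sub0: "subspace X0" "X0 \<subseteq> X"
    using subspace lf by (auto simp: X0_def subspace_def linear_0 linear_add linear_scale)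
  have "\<exists>E. orthonormal_basis X0 b E"
    using insert.IH[OF inner_form_subset[OF sub0]] insert.prems X0_def by auto
  then obtain E where E: "finite E" "E \<subseteq> X0" "\<forall>e\<in>E. \<forall>f\<in>E. b e f = (if e = f then 1 else 0)"
    "\<And>x. x\<in>X0 \<Longrightarrow> x = (\<Sum>e\<in>E. b x e *\<^sub>R e)"
    unfolding orthonormal_basis_def by blast
  have EX: "\<And>e. e \<in> E \<Longrightarrow> e \<in> X" and fE: "\<And>e. e \<in> E \<Longrightarrow> f e = 0" using E sub0 X0_def by auto
  show ?case
  proof (cases "\<forall>x\<in>X. f x = 0")
    case True
    then have "X0 = X" by (auto simp: X0_def)
    then show ?thesis using \<open>\<exists>E. orthonormal_basis X0 b E\<close> by simp
  next
    case False
    then obtain u where u: "u \<in> X" "f u \<noteq> 0" by blast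
    define s where "s = (\<Sum>e\<in>E. b u e *\<^sub>R e)"
    have s: "s \<in> X" unfolding s_def using subspace EX by (auto intro: subspace_sum subspace_scale)
    have fs: "f s = 0" unfolding s_def using lf fE by (simp add: linear_sum linear_scale)
    have bs: "b s e = b u e" if "e \<in> E" for e
    proof -
      have "b s e = (\<Sum>d\<in>E. b u d * b d e)" unfolding s_def using EX that by (simp add: sum_left)
      also have "\<dots> = (\<Sum>d\<in>E. if d = e then b u e else 0)" using E(3) that by (intro sum.cong) auto
      finally show ?thesis using E(1) that by simp
    qed
    define v where "v = u - s"
    have v: "v \<in> X" "f v \<noteq> 0" "v \<noteq> 0" "\<And>e. e \<in> E \<Longrightarrow> b v e = 0"
      using u s fs lf subspace bs EX by (auto simp: v_def linear_diff subspace_diff diff_left)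
    define n where "n = sqrt (b v v)"
    have n: "n > 0" "n * n = b v v" using pos[of v] v unfolding n_def by auto
    define e0 where "e0 = (1 / n) *\<^sub>R v"
    have e0: "e0 \<in> X" "f e0 \<noteq> 0" "\<And>e. e \<in> E \<Longrightarrow> b e0 e = 0" "b e0 e0 = 1"
      using v n subspace EX lf
      by (auto simp: e0_def subspace_scale linear_scale scale_left scale_right n(2)[symmetric])
    have e0': "\<And>e. e \<in> E \<Longrightarrow> b e e0 = 0" using e0 EX sym by metis
    have nin: "e0 \<notin> E" using e0(2) fE by auto
    have "x = (\<Sum>e\<in>insert e0 E. b x e *\<^sub>R e)" if x: "x \<in> X" for x
    proof -
      \<comment> \<open>This c moves x into the kernel of f, where the induction hypothesis expands
        the remainder in \<open>E\<close>. Pairing the expansion with \<open>e0\<close> then shows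
        that c is the Fourier coefficient of x at \<open>e0\<close>.\<close>
      define c where "c = f x / f e0"
      have y: "x - c *\<^sub>R e0 \<in> X0"
        using x e0 subspace lf by (auto simp: X0_def c_def subspace_diff subspace_scale linear_diff linear_scale)
      have b: "b (x - c *\<^sub>R e0) e = b x e" if "e \<in> E" for e
        using x e0 EX that subspace by (simp add: diff_left scale_left subspace_scale)
      have eq: "x - c *\<^sub>R e0 = (\<Sum>e\<in>E. b x e *\<^sub>R e)" using E(4)[OF y] b by simp
      then have "b (x - c *\<^sub>R e0) e0 = 0"
        using e0' e0 EX by (simp add: sum_left)
      then have "b x e0 = c" using x e0 subspace by (simp add: diff_left scale_left subspace_scale)
      with eq show ?thesis using nin E(1) by (simp add: algebra_simps)
    qed
    moreover have "\<forall>e\<in>insert e0 E. \<forall>f\<in>insert e0 E. b e f = (if e = f then 1 else 0)"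
      using E(3) e0 e0' nin by auto
    ultimately show ?thesis
      using E(1) EX e0(1) by (intro exI[of _ "insert e0 E"]) (auto simp: orthonormal_basis_def)
  qed
qed

lemma (in inner_form) orthonormal_basis_exists:
  assumes "separated X"
  obtains E where "finite E" "E \<subseteq> X" "\<And>e f. e \<in> E \<Longrightarrow> f \<in> E \<Longrightarrow> b e f = (if e = f then 1 else 0)"
    "\<And>x. x \<in> X \<Longrightarrow> x = (\<Sum>e\<in>E. b x e *\<^sub>R e)"
proof -
  obtain E where "orthonormal_basis X b E"
    using assms orthonormal_basis_exists_aux[OF _ inner_form_axioms] unfolding separated_def by metis
  then show ?thesis using that unfolding orthonormal_basis_def by blast
qed

text \<open>In coordinates with respect to a b-orthonormal basis, b x x is the sum of the squared
  coefficients, so each squared coefficient is at most b x x. The bound C is therefore the sum of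
  the absolute values of the entries of a in that basis. This is the comparison of norms in finite
  dimension, obtained without a topology on X.\<close>

lemma form_bounded_by_inner_form:
  assumes "symmetric_form X a" "inner_form X b" "separated X"
  obtains C where "\<And>x. x \<in> X \<Longrightarrow> a x x \<le> C * b x x"
proof -
  interpret a: symmetric_form X a by fact
  interpret b: inner_form X b by fact
  obtain E where E: "finite E" "E \<subseteq> X"
    "\<And>e f. e \<in> E \<Longrightarrow> f \<in> E \<Longrightarrow> b e f = (if e = f then 1 else 0)"
    "\<And>x. x \<in> X \<Longrightarrow> x = (\<Sum>e\<in>E. b x e *\<^sub>R e)"
    using b.orthonormal_basis_exists assms(3) by metis
  have EX: "\<And>e. e \<in> E \<Longrightarrow> e \<in> X" using E by auto
  show ?thesis
  proof
    fix x assume x: "x \<in> X"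
    define c where "c e = b x e" for e
    have xe: "x = (\<Sum>e\<in>E. c e *\<^sub>R e)" using E(4)[OF x] by (simp add: c_def)
    have "b x x = (\<Sum>e\<in>E. c e * b e x)"
      using b.sum_left[of E "\<lambda>e. e" x c] EX x xe by simp
    also have "\<dots> = (\<Sum>e\<in>E. (c e)\<^sup>2)"
      using EX x by (intro sum.cong) (auto simp: c_def b.sym[of x] power2_eq_square)
    finally have bx: "b x x = (\<Sum>e\<in>E. (c e)\<^sup>2)" .
    then have le: "(c e)\<^sup>2 \<le> b x x" if "e \<in> E" for e
      using member_le_sum[of e E "\<lambda>e. (c e)\<^sup>2"] that E(1) by simp
    have "a x x = (\<Sum>e\<in>E. c e * a e x)"
      using a.sum_left[of E "\<lambda>e. e" x c] EX x xe by simp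
    also have "\<dots> = (\<Sum>e\<in>E. \<Sum>f\<in>E. c e * (c f * a e f))"
      using a.sum_right[of E "\<lambda>e. e" _ c] EX xe by (simp add: sum_distrib_left)
    also have "\<dots> \<le> (\<Sum>e\<in>E. \<Sum>f\<in>E. \<bar>a e f\<bar> * b x x)"
    proof (intro sum_mono)
      fix e f assume "e \<in> E" "f \<in> E"
      have "c e * (c f * a e f) \<le> \<bar>c e * c f\<bar> * \<bar>a e f\<bar>"
        by (metis abs_ge_self abs_mult mult.assoc)
      also have "\<bar>c e * c f\<bar> \<le> ((c e)\<^sup>2 + (c f)\<^sup>2) / 2"
        using sum_squares_bound[of "\<bar>c e\<bar>" "\<bar>c f\<bar>"] by (simp add: abs_mult)
      also have "\<dots> \<le> b x x" using le[OF \<open>e \<in> E\<close>] le[OF \<open>f \<in> E\<close>] by simp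
      finally show "c e * (c f * a e f) \<le> \<bar>a e f\<bar> * b x x" by (simp add: mult.commute mult_right_mono)
    qed
    also have "\<dots> = (\<Sum>e\<in>E. \<Sum>f\<in>E. \<bar>a e f\<bar>) * b x x" by (simp add: sum_distrib_right)
    finally show "a x x \<le> (\<Sum>e\<in>E. \<Sum>f\<in>E. \<bar>a e f\<bar>) * b x x" .
  qed
qed

text \<open>The minimiser is the component of \<open>w\<close> orthogonal to the kernel of \<open>L\<close>.\<close>

lemma (in inner_form) minimal_preimage:
  assumes "separated X" "linear_on X L" "w \<in> X"
  shows "\<exists>y\<in>X. L y = L w \<and> (\<forall>z\<in>X. L z = L w \<longrightarrow> b y y \<le> b z z)"
proof -
  define Z where "Z = {z\<in>X. L z = 0}"
  have Z: "subspace Z" "Z \<subseteq> X"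
    using subspace assms(2) linear_on_0[OF assms(2) subspace]
    by (auto simp: Z_def subspace_def linear_on_def)
  interpret Z: inner_form Z b using Z by (rule inner_form_subset)
  obtain E where E: "finite E" "E \<subseteq> Z"
    "\<And>e f. e \<in> E \<Longrightarrow> f \<in> E \<Longrightarrow> b e f = (if e = f then 1 else 0)"
    "\<And>x. x \<in> Z \<Longrightarrow> x = (\<Sum>e\<in>E. b x e *\<^sub>R e)"
    using Z.orthonormal_basis_exists separated_mono[OF assms(1) Z(2)] by metis
  have EX: "\<And>e. e \<in> E \<Longrightarrow> e \<in> X" "\<And>e. e \<in> E \<Longrightarrow> L e = 0" using E(2) by (auto simp: Z_def)
  define s where "s = (\<Sum>e\<in>E. b w e *\<^sub>R e)"
  have s: "s \<in> X" unfolding s_def using subspace EX by (auto intro: subspace_sum subspace_scale)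
  have Ls: "L s = 0" unfolding s_def using EX linear_on_sum[OF assms(2) subspace, of E "\<lambda>e. e"] by simp
  have bs: "b s e = b w e" if "e \<in> E" for e
  proof -
    have "b s e = (\<Sum>d\<in>E. b w d * b d e)" unfolding s_def using EX that by (simp add: sum_left)
    also have "\<dots> = (\<Sum>d\<in>E. if d = e then b w e else 0)" using E(3) that by (intro sum.cong) auto
    finally show ?thesis using E(1) that by simp
  qed
  define y where "y = w - s"
  have y: "y \<in> X" "L y = L w"
    using s assms(2,3) subspace Ls linear_on_diff[OF assms(2) subspace assms(3) s]
    by (auto simp: y_def subspace_diff)
  have orth: "b y z = 0" if "z \<in> Z" for z
  proof -
    have "b y (\<Sum>e\<in>E. b z e *\<^sub>R e) = 0"
      using EX y assms(3) s bs sum_right[of E "\<lambda>e. e" y] by (simp add: y_def diff_left)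
    then show ?thesis using E(4)[OF that] by simp
  qed
  show ?thesis
  proof (intro bexI[of _ y] conjI ballI impI)
    fix z assume z: "z \<in> X" "L z = L w"
    then have d: "z - y \<in> Z" using y subspace linear_on_diff[OF assms(2) subspace, of z y]
      by (auto simp: Z_def subspace_diff)
    then have dX: "z - y \<in> X" using Z by auto
    have "b z z = b (y + (z - y)) (y + (z - y))" by simp
    also have "\<dots> = b y y + b (z - y) (z - y)"
      using orth[OF d] sym[OF dX y(1)] y dX subspace
      by (simp only: add_left add_right subspace_add)
    finally show "b y y \<le> b z z" using nonneg[OF dX] by simp
  qed (use y in auto)
qed

text \<open>Preimages of the vectors of an orthonormal basis of V extend to a linear right inverse
  of L. Pulling Q back along it gives a form on V, and such a form is bounded by A. For
  decompositions this says that some finite stability constant exists.\<close>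

lemma bounded_right_inverse:
  assumes "inner_form W Q" "inner_form V A" "separated V" "linear_on W L" "L ` W = V"
  obtains C where "\<And>v. v \<in> V \<Longrightarrow> \<exists>w\<in>W. v = L w \<and> Q w w \<le> C * A v v"
proof -
  interpret Q: inner_form W Q by fact
  interpret A: inner_form V A by fact
  obtain E where E: "finite E" "E \<subseteq> V"
    "\<And>e f. e \<in> E \<Longrightarrow> f \<in> E \<Longrightarrow> A e f = (if e = f then 1 else 0)"
    "\<And>x. x \<in> V \<Longrightarrow> x = (\<Sum>e\<in>E. A x e *\<^sub>R e)"
    using A.orthonormal_basis_exists assms(3) by metis
  have "\<forall>e\<in>E. \<exists>w\<in>W. L w = e" using E(2) assms(5) by blast
  then obtain g where g: "\<And>e. e \<in> E \<Longrightarrow> g e \<in> W" "\<And>e. e \<in> E \<Longrightarrow> L (g e) = e" by metis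
  define G where "G v = (\<Sum>e\<in>E. A v e *\<^sub>R g e)" for v
  have EV: "\<And>e. e \<in> E \<Longrightarrow> e \<in> V" using E by auto
  have GW: "G v \<in> W" for v
    unfolding G_def using g Q.subspace by (auto intro: subspace_sum subspace_scale)
  have LG: "L (G v) = v" if "v \<in> V" for v
  proof -
    have "L (G v) = (\<Sum>e\<in>E. A v e *\<^sub>R L (g e))"
      unfolding G_def using g(1) by (intro linear_on_sum[OF assms(4) Q.subspace])
    also have "\<dots> = (\<Sum>e\<in>E. A v e *\<^sub>R e)" using g(2) by simp
    finally show ?thesis using E(4)[OF that] by simp
  qed
  have "linear_on V G"
    using EV by (auto simp: linear_on_def G_def A.add_left A.scale_left scaleR_add_left sum.distrib
        scaleR_sum_right)
  then have "symmetric_form V (\<lambda>u v. Q (G u) (G v))"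
    using Q.pullback A.subspace GW by blast
  then obtain C where "\<And>v. v \<in> V \<Longrightarrow> Q (G v) (G v) \<le> C * A v v"
    using form_bounded_by_inner_form[OF _ assms(2,3)] by blast
  then show ?thesis using that GW LG by metis
qed

text \<open>The valid r form an intersection of closed sets that is bounded below by q i0 / p i0,
  hence contains its infimum. The index i0 gives both the lower bound and the positivity of the
  infimum; p may vanish at other indices, where the bound by r0 forces q i \<le> 0.\<close>

lemma least_ratio:
  fixes p q :: "'i \<Rightarrow> real"
  assumes "\<And>i. i \<in> I \<Longrightarrow> 0 \<le> p i" and "i0 \<in> I" "0 < q i0"
    and "\<And>i. i \<in> I \<Longrightarrow> q i \<le> r0 * p i"
  obtains r where "0 < r" "\<And>i. i \<in> I \<Longrightarrow> q i \<le> r * p i"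
    "\<And>s. (\<And>i. i \<in> I \<Longrightarrow> q i \<le> s * p i) \<Longrightarrow> r \<le> s"
proof -
  define S where "S = {r. \<forall>i\<in>I. q i \<le> r * p i}"
  have "p i0 \<noteq> 0" using assms(2,3) assms(4)[of i0] by auto
  then have p0: "0 < p i0" using assms(1)[OF assms(2)] by simp
  have lb: "q i0 / p i0 \<le> r" if "r \<in> S" for r
    using that assms(2) p0 by (auto simp: S_def field_simps)
  have S: "S \<noteq> {}" "bdd_below S" "closed S"
  proof -
    show "S \<noteq> {}" using assms(4) by (auto simp: S_def)
    show "bdd_below S" using lb by (auto simp: bdd_below_def)
    have "closed {r. q i \<le> r * p i}" for i by (intro closed_Collect_le continuous_intros)
    moreover have "S = (\<Inter>i\<in>I. {r. q i \<le> r * p i})" by (auto simp: S_def)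
    ultimately show "closed S" by auto
  qed
  have I: "Inf S \<in> S" using S closed_contains_Inf by blast
  show ?thesis
  proof
    show "0 < Inf S" using lb[OF I] assms(3) p0 by (meson divide_pos_pos less_le_trans)
    show "q i \<le> Inf S * p i" if "i \<in> I" for i using I that by (auto simp: S_def)
    show "Inf S \<le> s" if "\<And>i. i \<in> I \<Longrightarrow> q i \<le> s * p i" for s
      using S(2) that by (intro cInf_lower) (auto simp: S_def)
  qed
qed

text \<open>With y v a preimage of v of least energy, the existential condition becomes Q (y v) (y
  v) \<le> r * A v v, to which \<open>least_ratio\<close> applies. A nonzero vector of V gives a
  pair with positive energy; on V = {0} every real s would satisfy the condition.\<close>

lemma least_decomposition_constant:
  assumes "inner_form W Q" "inner_form V A" "separated W" "separated V" "linear_on W L" "L ` W = V"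
    and "V \<noteq> {0}"
  obtains r where "0 < r" "\<And>v. v \<in> V \<Longrightarrow> \<exists>w\<in>W. v = L w \<and> Q w w \<le> r * A v v"
    "\<And>s. (\<And>v. v \<in> V \<Longrightarrow> \<exists>w\<in>W. v = L w \<and> Q w w \<le> s * A v v) \<Longrightarrow> r \<le> s"
proof -
  interpret Q: inner_form W Q by fact
  interpret A: inner_form V A by fact
  have "\<forall>v\<in>V. \<exists>y\<in>W. L y = v \<and> (\<forall>z\<in>W. L z = v \<longrightarrow> Q y y \<le> Q z z)"
    using Q.minimal_preimage[OF assms(3,5)] assms(6) by blast
  then obtain y where y: "\<And>v. v \<in> V \<Longrightarrow> y v \<in> W" "\<And>v. v \<in> V \<Longrightarrow> L (y v) = v"
    "\<And>v z. v \<in> V \<Longrightarrow> z \<in> W \<Longrightarrow> L z = v \<Longrightarrow> Q (y v) (y v) \<le> Q z z" by metis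
  have iff: "(\<exists>w\<in>W. v = L w \<and> Q w w \<le> t) \<longleftrightarrow> Q (y v) (y v) \<le> t" if "v \<in> V" for v t
    using y that by (metis order_trans)
  obtain C where C: "\<And>v. v \<in> V \<Longrightarrow> Q (y v) (y v) \<le> C * A v v"
    using bounded_right_inverse[OF assms(1,2,4,5,6)] iff by metis
  obtain v0 where v0: "v0 \<in> V" "v0 \<noteq> 0" using assms(7) A.subspace subspace_0 by blast
  then have "y v0 \<noteq> 0" using y(2)[OF v0(1)] linear_on_0[OF assms(5) Q.subspace] by auto
  then have q0: "0 < Q (y v0) (y v0)" using Q.pos y v0 by blast
  obtain r where r: "0 < r" "\<And>v. v \<in> V \<Longrightarrow> Q (y v) (y v) \<le> r * A v v"
    "\<And>s. (\<And>v. v \<in> V \<Longrightarrow> Q (y v) (y v) \<le> s * A v v) \<Longrightarrow> r \<le> s"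
    using least_ratio[of V "\<lambda>v. A v v" v0 "\<lambda>v. Q (y v) (y v)", OF A.nonneg v0(1) q0 C] by blast
  show ?thesis
    by (rule that[OF r(1)]) (use r(2,3) in \<open>simp_all add: iff\<close>)
qed

section \<open>Existence of the Schwarz constants\<close>

lemma spd_on_iff_inner_form:
  assumes "symmetric_form V B" shows "spd_on V B \<longleftrightarrow> inner_form V B"
proof -
  interpret symmetric_form V B by fact
  show ?thesis
    using sym by (auto simp: spd_on_def inner_form_def inner_form_axioms_def symmetric_form_axioms zero_fun_def)
qed

text \<open>An additive Schwarz method without any mesh. The local forms are arbitrary, so that the
  existence results hold for inexact and exact local solvers alike.\<close>

locale schwarz_method =
  fixes V :: "scalar_fn set" and A :: form and M :: schwarz
  assumes finite_indices: "finite (indices M)"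
    and local_symmetric: "j \<in> indices M \<Longrightarrow> symmetric_form (local_space M j) (local_form M j)"
    and local_separated: "j \<in> indices M \<Longrightarrow> separated (local_space M j)"
    and prolong_linear: "j \<in> indices M \<Longrightarrow> linear_on (local_space M j) (prolong M j)"
    and prolong_into: "j \<in> indices M \<Longrightarrow> u \<in> local_space M j \<Longrightarrow> prolong M j u \<in> V"
    and energy_symmetric: "symmetric_form V A"
    and separated: "separated V"
    and admissible: "schwarz_admissible V A M"
begin

sublocale A: inner_form V A
  using admissible spd_on_iff_inner_form[OF energy_symmetric] unfolding schwarz_admissible_def by blast

lemma local_inner: "j \<in> indices M \<Longrightarrow> inner_form (local_space M j) (local_form M j)"
  using admissible spd_on_iff_inner_form[OF local_symmetric] by (simp add: schwarz_admissible_def)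

lemma local_subspace: "j \<in> indices M \<Longrightarrow> subspace (local_space M j)"
  using local_symmetric symmetric_form.subspace by blast

lemma assemble_onto: "assemble M ` local_families M = V"
  using admissible by (simp add: schwarz_admissible_def)

lemma assemble_eq: "assemble M w = (\<Sum>j\<in>indices M. prolong M j (w j))"
  by (simp add: assemble_def fun_eq_iff sum_fun_apply)

definition local_energy :: "(nat \<Rightarrow> scalar_fn) \<Rightarrow> (nat \<Rightarrow> scalar_fn) \<Rightarrow> real" where
  "local_energy w z = (\<Sum>j\<in>indices M. local_form M j (w j) (z j))"

text \<open>Families are normalised to vanish off the index set, where \<^const>\<open>local_families\<close> leaves them
  arbitrary.\<close>

definition families :: "(nat \<Rightarrow> scalar_fn) set" where
  "families = {w \<in> local_families M. \<forall>j. j \<notin> indices M \<longrightarrow> w j = 0}"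

lemma mem_families: "w \<in> families \<Longrightarrow> j \<in> indices M \<Longrightarrow> w j \<in> local_space M j"
  by (auto simp: families_def local_families_def)

lemma normalised_family:
  assumes "w \<in> local_families M"
  obtains z where "z \<in> families" "assemble M z = assemble M w"
    "local_energy z z = local_energy w w"
proof
  let ?z = "\<lambda>j. if j \<in> indices M then w j else 0"
  show "?z \<in> families" using assms by (auto simp: families_def local_families_def)
  show "assemble M ?z = assemble M w" by (simp add: assemble_eq)
  show "local_energy ?z ?z = local_energy w w" by (simp add: local_energy_def)
qed

text \<open>Definiteness is the point where the normalisation matters: a nonzero family is nonzero
  at some index of \<open>M\<close>, and that index contributes a positive summand.\<close>

lemma inner_form_local_energy: "inner_form families local_energy"
proof
  show "subspace families"
    using local_subspace
    by (auto simp: subspace_def families_def local_families_def)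
  note simps = symmetric_form.sym[OF local_symmetric mem_families mem_families]
    symmetric_form.add_left[OF local_symmetric mem_families mem_families mem_families]
    symmetric_form.scale_left[OF local_symmetric mem_families mem_families]
  fix x y z and r
  assume x: "x \<in> families"
  { assume y: "y \<in> families"
    show "local_energy x y = local_energy y x"
      unfolding local_energy_def by (intro sum.cong refl simps) (use x y in auto)
    assume "z \<in> families"
    then show "local_energy (x + y) z = local_energy x z + local_energy y z"
      unfolding local_energy_def sum.distrib[symmetric] plus_fun_apply[of x y]
      by (intro sum.cong refl simps) (use x y in auto) }
  { assume "z \<in> families"
    then show "local_energy (r *\<^sub>R x) z = r * local_energy x z"
      unfolding local_energy_def sum_distrib_left scaleR_fun_apply[of r x]
      by (intro sum.cong refl simps) (use x in auto) }
  assume "x \<noteq> 0"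
  then obtain j where "x j \<noteq> 0" by (auto simp: fun_eq_iff)
  then have j: "j \<in> indices M" using x by (auto simp: families_def)
  show "0 < local_energy x x"
    unfolding local_energy_def
    using finite_indices j \<open>x j \<noteq> 0\<close> x mem_families
    by (intro sum_pos2[of _ j] inner_form.pos[OF local_inner] inner_form.nonneg[OF local_inner]) auto
qed

text \<open>The separating functionals of each local space are composed with the component map from
  w to w j. Components off the index set vanish by normalisation.\<close>

lemma separated_families: "separated families"
proof -
  obtain P where P: "\<And>j. j \<in> indices M \<Longrightarrow> finite (P j)"
    "\<And>j f. j \<in> indices M \<Longrightarrow> f \<in> P j \<Longrightarrow> linear (f :: scalar_fn \<Rightarrow> real)"
    "\<And>j x. j \<in> indices M \<Longrightarrow> x \<in> local_space M j \<Longrightarrow> (\<forall>f\<in>P j. f x = 0) \<Longrightarrow> x = 0"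
    using local_separated unfolding separated_def by metis
  let ?P = "\<Union>j\<in>indices M. (\<lambda>f w. f (w j)) ` P j"
  have "linear (\<lambda>w. f (w j))" if "j \<in> indices M" "f \<in> P j" for f j
    using P(2)[OF that] by (auto intro!: linearI simp: linear_add linear_scale)
  moreover have "w = 0" if "w \<in> families" "\<forall>g\<in>?P. g w = 0" for w
  proof
    show "w j = 0 j" for j
      using that P(3)[of j "w j"] mem_families[of w j] by (cases "j \<in> indices M") (auto simp: families_def)
  qed
  ultimately show ?thesis
    unfolding separated_def using finite_indices P(1) by (intro exI[of _ ?P]) auto
qed

lemma linear_on_assemble: "linear_on families (assemble M)"
  using prolong_linear mem_families
  by (auto simp: linear_on_def assemble_eq sum.distrib scaleR_sum_right intro!: sum.cong)

lemma assemble_families: "assemble M ` families = V"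
proof -
  have "v \<in> assemble M ` families" if "v \<in> V" for v
  proof -
    obtain w where w: "w \<in> local_families M" "v = assemble M w" using assemble_onto \<open>v \<in> V\<close> by blast
    obtain z where "z \<in> families" "assemble M z = assemble M w" using normalised_family[OF w(1)] .
    then show ?thesis using w(2) by (metis imageI)
  qed
  then show ?thesis using assemble_onto by (auto simp: families_def)
qed

text \<open>The left side has the shape found in \<open>C_0_def\<close>, so the definition can be
  rewritten directly to normalised families.\<close>

lemma decomposition_iff:
  "(\<exists>w\<in>local_families M. v = assemble M w \<and> (\<Sum>j\<in>indices M. local_form M j (w j) (w j)) \<le> t) \<longleftrightarrow>
   (\<exists>w\<in>families. v = assemble M w \<and> local_energy w w \<le> t)"
proof
  assume "\<exists>w\<in>local_families M. v = assemble M w \<and> (\<Sum>j\<in>indices M. local_form M j (w j) (w j)) \<le> t"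
  then obtain w where w: "w \<in> local_families M" "v = assemble M w" "local_energy w w \<le> t"
    unfolding local_energy_def by blast
  obtain z where "z \<in> families" "assemble M z = assemble M w" "local_energy z z = local_energy w w"
    using normalised_family[OF w(1)] .
  then show "\<exists>w\<in>families. v = assemble M w \<and> local_energy w w \<le> t" using w by metis
qed (auto simp: families_def local_energy_def)

text \<open>\<open>LEAST\<close> ranges over C while the condition involves the square of C, so
  \<open>C_0\<close> is the square root of the least decomposition constant. Leastness is stated for
  the square, the quantity that enters \<open>kappa_ASM\<close>, and against an arbitrary real
  s.\<close>

lemma C_0_least:
  assumes "V \<noteq> {0}"
  shows "0 < C_0 V A M"
    and "v \<in> V \<Longrightarrow> \<exists>w\<in>local_families M. v = assemble M w \<and>
      (\<Sum>j\<in>indices M. local_form M j (w j) (w j)) \<le> (C_0 V A M)\<^sup>2 * A v v"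
    and "(\<And>v. v \<in> V \<Longrightarrow> \<exists>w\<in>local_families M. v = assemble M w \<and>
      (\<Sum>j\<in>indices M. local_form M j (w j) (w j)) \<le> s * A v v) \<Longrightarrow> (C_0 V A M)\<^sup>2 \<le> s"
proof -
  obtain r where r: "0 < r"
    "\<And>v. v \<in> V \<Longrightarrow> \<exists>w\<in>families. v = assemble M w \<and> local_energy w w \<le> r * A v v"
    "\<And>s. (\<And>v. v \<in> V \<Longrightarrow> \<exists>w\<in>families. v = assemble M w \<and> local_energy w w \<le> s * A v v) \<Longrightarrow> r \<le> s"
    using least_decomposition_constant[OF inner_form_local_energy A.inner_form_axioms
        separated_families separated linear_on_assemble assemble_families assms] by blast
  have "C_0 V A M = sqrt r"
    unfolding C_0_def decomposition_iff
  proof (rule Least_equality)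
    show "0 < sqrt r \<and> (\<forall>v\<in>V. \<exists>w\<in>families. v = assemble M w \<and> local_energy w w \<le> (sqrt r)\<^sup>2 * A v v)"
      using r(1,2) by simp
    show "sqrt r \<le> C"
      if "0 < C \<and> (\<forall>v\<in>V. \<exists>w\<in>families. v = assemble M w \<and> local_energy w w \<le> C\<^sup>2 * A v v)" for C
      using r(3)[of "C\<^sup>2"] that by (intro real_le_lsqrt) auto
  qed
  then have C: "0 < C_0 V A M" "(C_0 V A M)\<^sup>2 = r" using r(1) by auto
  show "0 < C_0 V A M" by (fact C)
  show "v \<in> V \<Longrightarrow> \<exists>w\<in>local_families M. v = assemble M w \<and>
      (\<Sum>j\<in>indices M. local_form M j (w j) (w j)) \<le> (C_0 V A M)\<^sup>2 * A v v"
    unfolding decomposition_iff C by (fact r)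
  show "(\<And>v. v \<in> V \<Longrightarrow> \<exists>w\<in>local_families M. v = assemble M w \<and>
      (\<Sum>j\<in>indices M. local_form M j (w j) (w j)) \<le> s * A v v) \<Longrightarrow> (C_0 V A M)\<^sup>2 \<le> s"
    unfolding decomposition_iff C by (fact r)
qed

lemma nonzero_family:
  assumes "V \<noteq> {0}"
  obtains w where "w \<in> local_families M" "0 < A (assemble M w) (assemble M w)"
proof -
  obtain v where "v \<in> V" "v \<noteq> 0" using assms A.subspace subspace_0 by blast
  then show ?thesis using A.pos[of v] assemble_onto that by blast
qed

text \<open>A nonzero assembled function has a nonzero summand. Such a summand keeps
  \<open>omega_0\<close> away from 0, and it makes the value 1 sharp for exact solvers.\<close>

lemma nonzero_prolong:
  assumes "V \<noteq> {0}"
  obtains j u where "j \<in> indices M" "u \<in> local_space M j" "0 < A (prolong M j u) (prolong M j u)"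
proof -
  obtain w where w: "w \<in> local_families M" "0 < A (assemble M w) (assemble M w)"
    using nonzero_family[OF assms] .
  then have "assemble M w \<noteq> 0" using A.zero_left[of 0] subspace_0[OF A.subspace] by auto
  then obtain j where j: "j \<in> indices M" "prolong M j (w j) \<noteq> 0"
    unfolding assemble_eq by (meson sum.neutral)
  then show ?thesis using that A.pos prolong_into w by (auto simp: local_families_def)
qed

lemma omega_0_least:
  assumes "V \<noteq> {0}"
  shows "0 < omega_0 A M"
    and "j \<in> indices M \<Longrightarrow> u \<in> local_space M j \<Longrightarrow>
      A (prolong M j u) (prolong M j u) \<le> omega_0 A M * local_form M j u u"
proof -
  let ?I = "Sigma (indices M) (local_space M)"
  let ?p = "\<lambda>(j, u). local_form M j u u" and ?q = "\<lambda>(j, u). A (prolong M j u) (prolong M j u)"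
  have "\<exists>C. \<forall>u\<in>local_space M j. A (prolong M j u) (prolong M j u) \<le> C * local_form M j u u"
    if j: "j \<in> indices M" for j
  proof -
    have "symmetric_form (local_space M j) (\<lambda>u v. A (prolong M j u) (prolong M j v))"
      using A.pullback[OF local_subspace prolong_linear] prolong_into j by blast
    then show ?thesis
      using form_bounded_by_inner_form[OF _ local_inner[OF j] local_separated[OF j]] by metis
  qed
  then obtain C where C: "\<And>j u. j \<in> indices M \<Longrightarrow> u \<in> local_space M j \<Longrightarrow>
    A (prolong M j u) (prolong M j u) \<le> C j * local_form M j u u" by metis
  have nn: "0 \<le> local_form M j u u" if "j \<in> indices M" "u \<in> local_space M j" for j u
    using that inner_form.nonneg[OF local_inner] by blast
  \<comment> \<open>The local problems have separate constants C j, whereas \<open>omega_0\<close>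
    is one constant for all of them; the sum of the absolute values dominates each C j.\<close>
  have bound: "?q i \<le> (\<Sum>j\<in>indices M. \<bar>C j\<bar>) * ?p i" if "i \<in> ?I" for i
  proof -
    obtain j u where i: "i = (j, u)" "j \<in> indices M" "u \<in> local_space M j" using \<open>i \<in> ?I\<close> by auto
    have "C j \<le> (\<Sum>j\<in>indices M. \<bar>C j\<bar>)"
      using member_le_sum[of j "indices M" "\<lambda>j. \<bar>C j\<bar>"] i finite_indices by auto
    then have "C j * local_form M j u u \<le> (\<Sum>j\<in>indices M. \<bar>C j\<bar>) * local_form M j u u"
      using nn i by (intro mult_right_mono) auto
    then show ?thesis using C i by fastforce
  qed
  obtain j0 u0 where j0: "j0 \<in> indices M" "u0 \<in> local_space M j0"
    "0 < A (prolong M j0 u0) (prolong M j0 u0)"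
    using nonzero_prolong[OF assms] .
  obtain r where r: "0 < r" "\<And>i. i \<in> ?I \<Longrightarrow> ?q i \<le> r * ?p i"
    "\<And>s. (\<And>i. i \<in> ?I \<Longrightarrow> ?q i \<le> s * ?p i) \<Longrightarrow> r \<le> s"
  proof (rule least_ratio[of ?I ?p "(j0, u0)" ?q, OF _ _ _ bound])
    show "0 \<le> ?p i" if "i \<in> ?I" for i using nn that by auto
  qed (use j0 in simp_all)
  have "omega_0 A M = r"
    unfolding omega_0_def
  proof (rule Least_equality)
    show "0 < r \<and> (\<forall>j\<in>indices M. \<forall>w\<in>local_space M j.
        A (prolong M j w) (prolong M j w) \<le> r * local_form M j w w)"
      using r(1,2) by auto
  qed (use r(3) in auto)
  then show "0 < omega_0 A M" "j \<in> indices M \<Longrightarrow> u \<in> local_space M j \<Longrightarrow>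
      A (prolong M j u) (prolong M j u) \<le> omega_0 A M * local_form M j u u"
    using r(1) r(2)[of "(j, u)"] by auto
qed

text \<open>\<open>tau_0\<close> is the reciprocal of the best r with ?q w \<le> r * ?p w; the
  number of subspaces is one such r, by \<open>sum_energy_le\<close>. The quantifier over all t up
  to the bound is harmless: ?p w is nonnegative, so a smaller t only weakens the inequality.\<close>

lemma tau_0_pos:
  assumes "V \<noteq> {0}" shows "0 < tau_0 A M"
proof -
  let ?p = "\<lambda>w. \<Sum>j\<in>indices M. A (prolong M j (w j)) (prolong M j (w j))"
  let ?q = "\<lambda>w. A (assemble M w) (assemble M w)"
  have mem: "prolong M j (w j) \<in> V" if "w \<in> local_families M" "j \<in> indices M" for w j
    using that prolong_into by (auto simp: local_families_def)
  have nn: "0 \<le> ?p w" if "w \<in> local_families M" for w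
    using mem[OF that] by (intro sum_nonneg A.nonneg)
  have bound: "?q w \<le> real (card (indices M)) * ?p w" if "w \<in> local_families M" for w
    unfolding assemble_eq using finite_indices mem[OF that] by (rule A.sum_energy_le)
  obtain w0 where "w0 \<in> local_families M" "0 < ?q w0" using nonzero_family[OF assms] .
  then obtain r where r: "0 < r" "\<And>w. w \<in> local_families M \<Longrightarrow> ?q w \<le> r * ?p w"
    "\<And>s. (\<And>w. w \<in> local_families M \<Longrightarrow> ?q w \<le> s * ?p w) \<Longrightarrow> r \<le> s"
    using least_ratio[of "local_families M" ?p w0 ?q, OF nn _ _ bound] by blast
  have "tau_0 A M = 1 / r"
    unfolding tau_0_def
  proof (rule Greatest_equality)
    show "0 < 1 / r \<and> (\<forall>w\<in>local_families M. \<forall>t\<in>{0<..1 / r}. ?q w \<le> 1 / t * ?p w)"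
    proof (intro conjI ballI)
      fix w t assume w: "w \<in> local_families M" and t: "t \<in> {0<..1 / r}"
      have "r \<le> 1 / t" using t r(1) by (simp add: field_simps)
      then have "r * ?p w \<le> 1 / t * ?p w" using nn[OF w] by (rule mult_right_mono)
      then show "?q w \<le> 1 / t * ?p w" using r(2)[OF w] by (rule order_trans[rotated])
    qed (use r(1) in simp)
    show "t \<le> 1 / r" if "0 < t \<and> (\<forall>w\<in>local_families M. \<forall>s\<in>{0<..t}. ?q w \<le> 1 / s * ?p w)" for t
    proof -
      have "r \<le> 1 / t" using that by (intro r(3)) auto
      then show ?thesis using that r(1) by (simp add: field_simps)
    qed
  qed
  then show ?thesis using r(1) by simp
qed

end

section \<open>Comparison of Galerkin local solvers with exact ones\<close>

lemma kappa_ASM_exact_solvers_le: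
  assumes "schwarz_method V A M" "schwarz_method V A M'"
    and same: "indices M' = indices M" "local_space M' = local_space M" "prolong M' = prolong M"
    and exact: "local_form M' = (\<lambda>j u v. A (prolong M j u) (prolong M j v))"
    and galerkin: "local_form M = (\<lambda>j u v. B (prolong M j u) (prolong M j v))"
    and "B 0 0 = 0"
  shows "kappa_ASM V A M' \<le> kappa_ASM V A M"
proof -
  interpret M: schwarz_method V A M by fact
  interpret M': schwarz_method V A M' by fact
  have fam: "local_families M' = local_families M" by (simp add: local_families_def same)
  have asm: "assemble M' = assemble M" by (simp add: assemble_def fun_eq_iff same)
  have tau: "tau_0 A M' = tau_0 A M" by (simp add: tau_0_def fam asm same)
  show ?thesis
  proof (cases "V = {0}")
    case True
    txt \<open>None of the extremal constants exists now, but the predicates defining them agree for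
      \<^term>\<open>M\<close> and \<^term>\<open>M'\<close>, hence so do the junk values.\<close>
    have zero: "prolong M j u = 0" if "j \<in> indices M" "u \<in> local_space M j" for j u
      using M.prolong_into[OF that] True by simp
    have "A 0 0 = 0" using True by simp
    \<comment> \<open>Both forms are evaluated at prolonged functions, all of which are 0 here, so
      \<open>B 0 0 = 0\<close> settles the side of \<open>M\<close>.\<close>
    then have eq: "local_form M' j u u = local_form M j u u"
      if "j \<in> indices M" "u \<in> local_space M j" for j u
      using zero[OF that] \<open>B 0 0 = 0\<close> by (simp add: exact galerkin)
    then have om: "omega_0 A M' = omega_0 A M" by (simp add: omega_0_def same)
    have "(\<Sum>j\<in>indices M. local_form M' j (w j) (w j)) = (\<Sum>j\<in>indices M. local_form M j (w j) (w j))"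
      if "w \<in> local_families M" for w
      using that by (intro sum.cong eq) (auto simp: local_families_def)
    then have "C_0 V A M' = C_0 V A M" by (simp add: C_0_def fam asm same cong: bex_cong)
    then show ?thesis by (simp add: kappa_ASM_def om tau)
  next
    case False
    let ?o = "omega_0 A M" and ?C = "C_0 V A M"
    have om': "omega_0 A M' = 1"
      unfolding omega_0_def
    proof (rule Least_equality)
      show "0 < (1::real) \<and> (\<forall>j\<in>indices M'. \<forall>w\<in>local_space M' j.
          A (prolong M' j w) (prolong M' j w) \<le> 1 * local_form M' j w w)"
        by (simp add: exact same)
      \<comment> \<open>For exact solvers the defining inequality reads E \<le> y * E with E the
        energy of a prolonged function; a single positive E forces y to be at least 1.\<close>
      obtain j u where "j \<in> indices M" "u \<in> local_space M j" "0 < A (prolong M j u) (prolong M j u)"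
        using M.nonzero_prolong[OF False] .
      then show "1 \<le> y" if "0 < y \<and> (\<forall>j\<in>indices M'. \<forall>w\<in>local_space M' j.
          A (prolong M' j w) (prolong M' j w) \<le> y * local_form M' j w w)" for y
        using that unfolding exact same by (metis mult_le_cancel_right1 not_le)
    qed
    have "(C_0 V A M')\<^sup>2 \<le> ?o * ?C\<^sup>2"
    proof (rule M'.C_0_least(3)[OF False])
      fix v assume "v \<in> V"
      then obtain w where w: "w \<in> local_families M" "v = assemble M w"
        "(\<Sum>j\<in>indices M. local_form M j (w j) (w j)) \<le> ?C\<^sup>2 * A v v"
        using M.C_0_least(2)[OF False] by blast
      have "(\<Sum>j\<in>indices M. local_form M' j (w j) (w j)) \<le> (\<Sum>j\<in>indices M. ?o * local_form M j (w j) (w j))"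
        unfolding exact using w(1) by (intro sum_mono M.omega_0_least(2)[OF False]) (auto simp: local_families_def)
      also have "\<dots> \<le> ?o * (?C\<^sup>2 * A v v)"
        unfolding sum_distrib_left[symmetric]
        using w(3) M.omega_0_least(1)[OF False] by (intro mult_left_mono) auto
      finally show "\<exists>w\<in>local_families M'. v = assemble M' w \<and>
          (\<Sum>j\<in>indices M'. local_form M' j (w j) (w j)) \<le> ?o * ?C\<^sup>2 * A v v"
        using w(1,2) by (auto simp: fam asm same mult.assoc)
    qed
    then show ?thesis
      using M.tau_0_pos[OF False] by (simp add: kappa_ASM_def om' tau divide_right_mono)
  qed
qed

section \<open>Finite element spaces\<close>

lemma subspaceI_combination:
  assumes "0 \<in> X" "\<And>x y r. x \<in> X \<Longrightarrow> y \<in> X \<Longrightarrow> x + r *\<^sub>R y \<in> X"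
  shows "subspace X"
  using assms(1) assms(2)[of _ _ 1] assms(2)[of 0] by (auto simp: subspace_def)

section \<open>Test functions and the Sobolev space\<close>

lemma GDERIV_unique:
  assumes "GDERIV f x :> g" "GDERIV f x :> h" shows "g = h"
proof -
  have "(\<lambda>y. y \<bullet> g) = (\<lambda>y. y \<bullet> h)"
    using assms has_derivative_unique unfolding gderiv_def by blast
  then show ?thesis by (metis vector_eq_ldot)
qed

lemma grad_eq: "GDERIV u x :> g \<Longrightarrow> grad u x = g"
  unfolding grad_def using GDERIV_unique by blast

lemma GDERIV_combination:
  fixes f g :: scalar_fn
  assumes "GDERIV f x :> df" "GDERIV g x :> dg"
  shows "GDERIV (f + r *\<^sub>R g) x :> df + r *\<^sub>R dg"
proof -
  have "((\<lambda>x. f x + r * g x) has_derivative (\<lambda>h. h \<bullet> df + r * (h \<bullet> dg))) (at x)"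
    using assms unfolding gderiv_def by (intro derivative_intros)
  then show ?thesis
    by (simp add: gderiv_def plus_fun_def scaleR_fun_def inner_add_right)
qed

lemma C_k_combination: "C_k k f \<Longrightarrow> C_k k g \<Longrightarrow> C_k k (f + r *\<^sub>R g)"
proof (induction k arbitrary: f g)
  case 0
  then show ?case by (auto simp: plus_fun_def scaleR_fun_def intro!: continuous_intros)
next
  case (Suc k)
  from Suc.prems obtain F G where
    F: "\<And>x. GDERIV f x :> F x" "\<And>i. C_k k (\<lambda>x. F x $ i)" and
    G: "\<And>x. GDERIV g x :> G x" "\<And>i. C_k k (\<lambda>x. G x $ i)" by auto
  have "C_k k (\<lambda>x. (F x + r *\<^sub>R G x) $ i)" for i
    using Suc.IH[OF F(2)[of i] G(2)[of i]] by (simp add: plus_fun_def scaleR_fun_def)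
  then show ?case using GDERIV_combination[OF F(1) G(1)]
    unfolding C_k.simps by (intro exI[of _ "\<lambda>x. F x + r *\<^sub>R G x"]) blast
qed

lemma C_k_zero: "C_k k (\<lambda>_. 0)"
proof (induction k)
  case (Suc k)
  then show ?case
    by (auto simp: gderiv_def intro!: exI[of _ "\<lambda>_. 0"])
qed auto

lemma subspace_test_functions: "subspace (test_functions U)"
proof (rule subspaceI_combination)
  show "0 \<in> test_functions U"
    using C_k_zero by (auto simp: test_functions_def zero_fun_def intro!: exI[of _ "{}"])
  fix f g :: scalar_fn and r :: real
  assume "f \<in> test_functions U" "g \<in> test_functions U"
  then obtain S S' where "\<And>k. C_k k f" "\<And>k. C_k k g" and
    S: "compact S" "S \<subseteq> U" "\<And>x. x \<notin> S \<Longrightarrow> f x = 0"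
    "compact S'" "S' \<subseteq> U" "\<And>x. x \<notin> S' \<Longrightarrow> g x = 0"
    unfolding test_functions_def by blast
  moreover from S have "compact (S \<union> S')" "S \<union> S' \<subseteq> U" "\<And>x. x \<notin> S \<union> S' \<Longrightarrow> (f + r *\<^sub>R g) x = 0"
    by auto
  ultimately show "f + r *\<^sub>R g \<in> test_functions U"
    unfolding test_functions_def using C_k_combination by blast
qed

lemma test_function_GDERIV:
  assumes "f \<in> test_functions U" shows "GDERIV f x :> grad f x"
proof -
  have "C_k (Suc 0) f" using assms unfolding test_functions_def by blast
  then obtain g where "GDERIV f x :> g" by auto
  then show ?thesis using grad_eq by metis
qed

lemma continuous_on_test_function:
  assumes "f \<in> test_functions U" shows "continuous_on UNIV f"
proof -
  have "C_k 0 f" using assms unfolding test_functions_def by blast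
  then show ?thesis by simp
qed

lemma continuous_on_grad_test_function:
  assumes "f \<in> test_functions U" shows "continuous_on UNIV (grad f)"
proof -
  have "C_k (Suc 0) f" using assms unfolding test_functions_def by blast
  then obtain g where g: "\<And>x. GDERIV f x :> g x" "\<And>i. continuous_on UNIV (\<lambda>x. g x $ i)" by auto
  have "continuous_on UNIV (\<lambda>x. \<chi> i. g x $ i)" using g(2) by (intro continuous_on_vec_lambda)
  moreover have "grad f = g" using g(1) grad_eq by blast
  ultimately show ?thesis by simp
qed

lemma continuous_imp_measurable_lebesgue_on:
  fixes f :: "point \<Rightarrow> 'a::euclidean_space"
  assumes "continuous_on UNIV f" shows "f \<in> borel_measurable (lebesgue_on U)"
  using borel_measurable_continuous_onI[OF assms]
  by (intro measurable_restrict_space1) (simp add: measurable_completion)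

text \<open>This replaces the triangle inequality in the space of square integrable functions, in a
  form that asks for no integrability, as in the definition of \<open>H1_0\<close>. In its uses K is
  twice the square of the scalar r.\<close>

lemma nn_integral_combination_tendsto_0:
  fixes a b c :: "nat \<Rightarrow> 'a \<Rightarrow> real"
  assumes "\<And>n. a n \<in> borel_measurable M" "\<And>n. b n \<in> borel_measurable M"
    and "\<And>n x. 0 \<le> a n x" "\<And>n x. 0 \<le> b n x" "0 \<le> K"
    and le: "\<And>n x. c n x \<le> 2 * a n x + K * b n x"
    and "(\<lambda>n. \<integral>\<^sup>+x. ennreal (a n x) \<partial>M) \<longlonglongrightarrow> 0" "(\<lambda>n. \<integral>\<^sup>+x. ennreal (b n x) \<partial>M) \<longlonglongrightarrow> 0"
  shows "(\<lambda>n. \<integral>\<^sup>+x. ennreal (c n x) \<partial>M) \<longlonglongrightarrow> 0"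
proof (rule tendsto_sandwich[OF _ _ tendsto_const])
  have "(\<lambda>n. ennreal 2 * (\<integral>\<^sup>+x. ennreal (a n x) \<partial>M) + ennreal K * (\<integral>\<^sup>+x. ennreal (b n x) \<partial>M))
      \<longlonglongrightarrow> ennreal 2 * 0 + ennreal K * 0"
    by (intro tendsto_add ennreal_tendsto_cmult assms) auto
  then show "(\<lambda>n. ennreal 2 * (\<integral>\<^sup>+x. ennreal (a n x) \<partial>M) + ennreal K * (\<integral>\<^sup>+x. ennreal (b n x) \<partial>M))
      \<longlonglongrightarrow> 0" by simp
  have "(\<integral>\<^sup>+x. ennreal (c n x) \<partial>M) \<le>
      ennreal 2 * (\<integral>\<^sup>+x. ennreal (a n x) \<partial>M) + ennreal K * (\<integral>\<^sup>+x. ennreal (b n x) \<partial>M)" for n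
  proof -
    have "(\<integral>\<^sup>+x. ennreal (c n x) \<partial>M) \<le> (\<integral>\<^sup>+x. ennreal 2 * ennreal (a n x) + ennreal K * ennreal (b n x) \<partial>M)"
    proof (rule nn_integral_mono)
      fix x
      have "ennreal (c n x) \<le> ennreal (2 * a n x + K * b n x)" using le by (rule ennreal_leI)
      also have "\<dots> = ennreal 2 * ennreal (a n x) + ennreal K * ennreal (b n x)"
        using assms(3-5) by (subst ennreal_plus) (simp_all add: ennreal_mult)
      finally show "ennreal (c n x) \<le> ennreal 2 * ennreal (a n x) + ennreal K * ennreal (b n x)" .
    qed
    also have "\<dots> = ennreal 2 * (\<integral>\<^sup>+x. ennreal (a n x) \<partial>M) + ennreal K * (\<integral>\<^sup>+x. ennreal (b n x) \<partial>M)"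
      using assms(1,2)[of n] by (subst nn_integral_add) (auto simp: nn_integral_cmult)
    finally show ?thesis .
  qed
  then show "\<forall>\<^sub>F n in sequentially. (\<integral>\<^sup>+x. ennreal (c n x) \<partial>M) \<le>
      ennreal 2 * (\<integral>\<^sup>+x. ennreal (a n x) \<partial>M) + ennreal K * (\<integral>\<^sup>+x. ennreal (b n x) \<partial>M)" by simp
qed auto

text \<open>Approximating sequences and weak gradients are combined termwise with the same scalar;
  the gradient of the combined test functions splits because test functions are differentiable
  everywhere.\<close>

lemma subspace_H1_0: "subspace (H1_0 U)"
proof (rule subspaceI_combination)
  have g0: "grad (\<lambda>_. 0) x = 0" for x by (rule grad_eq) (simp add: gderiv_def)
  show "0 \<in> H1_0 U"
    unfolding H1_0_def using subspace_0[OF subspace_test_functions]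
    by (auto simp: g0 zero_fun_def[where 'a=point and 'b=real] intro!: exI[of _ "\<lambda>_. 0 :: point"] exI[of _ "\<lambda>_. 0 :: scalar_fn"])
  fix u v :: scalar_fn and r :: real
  assume "u \<in> H1_0 U" "v \<in> H1_0 U"
  then obtain G F G' F' where mu: "u \<in> borel_measurable (lebesgue_on U)" and mG: "G \<in> borel_measurable (lebesgue_on U)"
    and F: "\<And>n::nat. F n \<in> test_functions U"
    and u: "(\<lambda>n. \<integral>\<^sup>+x. ennreal ((F n x - u x)\<^sup>2) \<partial>lebesgue_on U) \<longlonglongrightarrow> 0"
      "(\<lambda>n. \<integral>\<^sup>+x. ennreal ((norm (grad (F n) x - G x))\<^sup>2) \<partial>lebesgue_on U) \<longlonglongrightarrow> 0"
    and mv: "v \<in> borel_measurable (lebesgue_on U)" and mG': "G' \<in> borel_measurable (lebesgue_on U)"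
    and F': "\<And>n::nat. F' n \<in> test_functions U"
    and v: "(\<lambda>n. \<integral>\<^sup>+x. ennreal ((F' n x - v x)\<^sup>2) \<partial>lebesgue_on U) \<longlonglongrightarrow> 0"
      "(\<lambda>n. \<integral>\<^sup>+x. ennreal ((norm (grad (F' n) x - G' x))\<^sup>2) \<partial>lebesgue_on U) \<longlonglongrightarrow> 0"
    unfolding H1_0_def by blast
  note [measurable] = mu mv mG mG' continuous_imp_measurable_lebesgue_on[OF continuous_on_test_function[OF F]]
    continuous_imp_measurable_lebesgue_on[OF continuous_on_test_function[OF F']]
    continuous_imp_measurable_lebesgue_on[OF continuous_on_grad_test_function[OF F]]
    continuous_imp_measurable_lebesgue_on[OF continuous_on_grad_test_function[OF F']]
  have grad: "grad (F n + r *\<^sub>R F' n) x = grad (F n) x + r *\<^sub>R grad (F' n) x" for n x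
    using F F' by (intro grad_eq GDERIV_combination test_function_GDERIV)
  \<comment> \<open>Stated for any inner product space, so that it covers the scalar values as well
    as the gradients.\<close>
  have norm2: "(norm (p + r *\<^sub>R q))\<^sup>2 \<le> 2 * (norm p)\<^sup>2 + (2 * r\<^sup>2) * (norm q)\<^sup>2" for p q :: "'z::real_inner"
  proof -
    have "(norm (p + r *\<^sub>R q))\<^sup>2 \<le> (norm p + \<bar>r\<bar> * norm q)\<^sup>2"
      by (intro power_mono norm_triangle_le) auto
    also have "\<dots> \<le> 2 * (norm p)\<^sup>2 + (2 * r\<^sup>2) * (norm q)\<^sup>2"
      using sum_squares_bound[of "norm p" "\<bar>r\<bar> * norm q"] by (simp add: power2_sum power_mult_distrib)
    finally show ?thesis .
  qed
  have 1: "(\<lambda>n. \<integral>\<^sup>+x. ennreal (((F n + r *\<^sub>R F' n) x - (u + r *\<^sub>R v) x)\<^sup>2) \<partial>lebesgue_on U) \<longlonglongrightarrow> 0"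
  proof (rule nn_integral_combination_tendsto_0[OF _ _ _ _ _ _ u(1) v(1)])
    show "((F n + r *\<^sub>R F' n) x - (u + r *\<^sub>R v) x)\<^sup>2 \<le> 2 * (F n x - u x)\<^sup>2 + (2 * r\<^sup>2) * (F' n x - v x)\<^sup>2" for n x
      using norm2[of "F n x - u x" "F' n x - v x"] by (simp add: algebra_simps)
  qed auto
  have 2: "(\<lambda>n. \<integral>\<^sup>+x. ennreal ((norm (grad (F n + r *\<^sub>R F' n) x - (G x + r *\<^sub>R G' x)))\<^sup>2) \<partial>lebesgue_on U) \<longlonglongrightarrow> 0"
  proof (rule nn_integral_combination_tendsto_0[OF _ _ _ _ _ _ u(2) v(2)])
    show "(norm (grad (F n + r *\<^sub>R F' n) x - (G x + r *\<^sub>R G' x)))\<^sup>2 \<le>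
        2 * (norm (grad (F n) x - G x))\<^sup>2 + (2 * r\<^sup>2) * (norm (grad (F' n) x - G' x))\<^sup>2" for n x
      using norm2[of "grad (F n) x - G x" "grad (F' n) x - G' x"] by (simp add: grad algebra_simps)
  qed auto
  have "F n + r *\<^sub>R F' n \<in> test_functions U" for n
    using F F' subspace_test_functions by (intro subspace_add subspace_scale)
  moreover have "u + r *\<^sub>R v \<in> borel_measurable (lebesgue_on U)" "(\<lambda>x. G x + r *\<^sub>R G' x) \<in> borel_measurable (lebesgue_on U)"
    unfolding plus_fun_def scaleR_fun_def by measurable
  ultimately show "u + r *\<^sub>R v \<in> H1_0 U"
    unfolding H1_0_def mem_Collect_eq using 1 2
    by (intro conjI exI[of _ "\<lambda>x. G x + r *\<^sub>R G' x"] exI[of _ "\<lambda>n. F n + r *\<^sub>R F' n"]) blast+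
qed

lemma subspace_P1: "subspace (P1 e)"
proof (rule subspaceI_combination)
  show "0 \<in> P1 e" unfolding P1_def by (auto intro!: exI[of _ 0])
  fix u v r assume "u \<in> P1 e" "v \<in> P1 e"
  then obtain a c a' c' where "\<forall>x\<in>e. u x = a \<bullet> x + c" "\<forall>x\<in>e. v x = a' \<bullet> x + c'"
    unfolding P1_def by blast
  then have "\<forall>x\<in>e. (u + r *\<^sub>R v) x = (a + r *\<^sub>R a') \<bullet> x + (c + r * c')"
    by (auto simp: inner_add_left algebra_simps)
  then show "u + r *\<^sub>R v \<in> P1 e" unfolding P1_def by blast
qed

lemma subspace_fe_space: "subspace (fe_space T U)"
proof (rule subspaceI_combination)
  show "0 \<in> fe_space T U"
    unfolding fe_space_def using subspace_0[OF subspace_H1_0] subspace_0[OF subspace_P1] by auto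
  show "u + r *\<^sub>R v \<in> fe_space T U" if "u \<in> fe_space T U" "v \<in> fe_space T U" for u v r
    using that subspace_H1_0[of U] subspace_P1
    unfolding fe_space_def by (auto intro!: subspace_add subspace_scale)
qed


section \<open>Affine functions on triangles\<close>

lemma affine_zero_on_convex_hull:
  fixes a :: "'a::real_inner"
  assumes "\<And>p. p \<in> S \<Longrightarrow> a \<bullet> p + c = 0" "x \<in> convex hull S"
  shows "a \<bullet> x + c = 0"
proof -
  have "convex {x. a \<bullet> x = - c}" by (rule convex_hyperplane)
  then have "convex hull S \<subseteq> {x. a \<bullet> x = - c}"
    using assms(1) by (intro hull_minimal) (auto simp: eq_neg_iff_add_eq_0)
  then show ?thesis using assms(2) by auto
qed

lemma affine_zero_on_interior:
  fixes a :: "'a::euclidean_space"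
  assumes "\<And>p. p \<in> S \<Longrightarrow> a \<bullet> p + c = 0" "interior S \<noteq> {}"
  shows "a = 0 \<and> c = 0"
proof (rule ccontr)
  assume "\<not> ?thesis"
  moreover have "c = 0" if "a = 0" using that assms interior_subset by fastforce
  ultimately have "a \<noteq> 0" by blast
  then have "interior {x. a \<bullet> x = - c} = {}" by (rule interior_hyperplane)
  moreover have "S \<subseteq> {x. a \<bullet> x = - c}" using assms(1) by (auto simp: eq_neg_iff_add_eq_0)
  ultimately show False using interior_mono assms(2) by blast
qed

text \<open>The map from (a, c) to the three values is linear between spaces of dimension three, so
  injectivity implies surjectivity. It is applied to the vertices of a triangle and to the Gauss
  points.\<close>

lemma affine_interpolation:
  fixes p :: "nat \<Rightarrow> point"
  assumes "\<And>a c. (\<And>k. k \<in> {1,2,3} \<Longrightarrow> a \<bullet> p k + c = 0) \<Longrightarrow> a = 0 \<and> c = 0"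
  obtains a c where "\<And>k. k \<in> {1,2,3} \<Longrightarrow> a \<bullet> p k + c = y k"
proof -
  define f :: "point \<times> real \<Rightarrow> real \<times> real \<times> real" where
    "f = (\<lambda>(a, c). (a \<bullet> p 1 + c, a \<bullet> p 2 + c, a \<bullet> p 3 + c))"
  have lin: "linear f"
    by (rule linearI) (auto simp: f_def inner_add_left algebra_simps)
  have "inj f"
    unfolding linear_injective_0[OF lin]
  proof (intro allI impI)
    fix z assume z: "f z = 0"
    obtain a c where ac: "z = (a, c)" by (cases z)
    have "a = 0 \<and> c = 0"
      using z ac by (intro assms) (auto simp: f_def zero_prod_def)
    then show "z = 0" using ac by (simp add: zero_prod_def)
  qed
  then have "surj f"
    using eucl.linear_injective_imp_surjective[OF lin] by (simp add: dim_UNIV)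
  then obtain a c where "f (a, c) = (y 1, y 2, y 3)" by (metis prod.exhaust surj_def)
  then show ?thesis using that[of a c] by (auto simp: f_def)
qed

text \<open>Three affinely independent points span the plane, hence the nonempty interior. The last
  fact is what places an element inside the closure of any region that contains its
  interior.\<close>

lemma triangle_facts:
  assumes "2 simplex (e :: point set)"
  shows "compact e" "convex e" "interior e \<noteq> {}" "e = convex hull (vertices e)"
    "\<exists>p :: nat \<Rightarrow> point. vertices e = p ` {1,2,3}"
    "e \<subseteq> closure (interior e)"
proof -
  show c: "compact e" "convex e" using assms compact_simplex convex_simplex by auto
  obtain C where C: "\<not> affine_dependent C" "card C = 3" "e = convex hull C"
    using assms unfolding simplex_def by auto
  have v: "vertices e = C"
    unfolding vertices_def C(3) using extreme_point_of_convex_hull_affine_independent[OF C(1)] by auto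
  show "e = convex hull (vertices e)" using C v by simp
  obtain a b d where abd: "C = {a, b, d}" "a \<noteq> b" "b \<noteq> d" "a \<noteq> d" using C(2) card_3_iff by metis
  show "\<exists>p :: nat \<Rightarrow> point. vertices e = p ` {1,2,3}"
    using abd v by (intro exI[of _ "\<lambda>k. if k = 1 then a else if k = 2 then b else d"]) auto
  show i: "interior e \<noteq> {}"
    using interior_convex_hull_eq_empty[of C] C by simp
  show "e \<subseteq> closure (interior e)"
    using convex_closure_interior[OF c(2) i] closure_subset by blast
qed

lemma finite_vertices: "2 simplex e \<Longrightarrow> finite (vertices e)"
  using triangle_facts(5) by (metis finite.emptyI finite.insertI finite_imageI)

lemma vertices_subset: "vertices e \<subseteq> e"
  by (auto simp: vertices_def extreme_point_of_def)

lemma triangle_affine_eqI: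
  assumes "2 simplex e" "\<And>p. p \<in> vertices e \<Longrightarrow> a \<bullet> p + c = a' \<bullet> p + c'" "x \<in> e"
  shows "a \<bullet> x + c = a' \<bullet> x + c'"
proof -
  have "(a - a') \<bullet> x + (c - c') = 0"
  proof (rule affine_zero_on_convex_hull)
    show "(a - a') \<bullet> p + (c - c') = 0" if "p \<in> vertices e" for p
      using assms(2)[OF that] by (simp add: inner_diff_left)
    show "x \<in> convex hull (vertices e)" using assms(3) triangle_facts(4)[OF assms(1)] by simp
  qed
  then show ?thesis by (simp add: inner_diff_left)
qed

lemma P1_eqI:
  assumes "2 simplex e" "u \<in> P1 e" "v \<in> P1 e" "\<And>p. p \<in> vertices e \<Longrightarrow> u p = v p" "x \<in> e"
  shows "u x = v x"
proof -
  obtain a c a' c' where u: "\<And>x. x \<in> e \<Longrightarrow> u x = a \<bullet> x + c" and v: "\<And>x. x \<in> e \<Longrightarrow> v x = a' \<bullet> x + c'"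
    using assms(2,3) unfolding P1_def by blast
  have "a \<bullet> p + c = a' \<bullet> p + c'" if "p \<in> vertices e" for p
    using assms(4)[OF that] u[of p] v[of p] that vertices_subset[of e] by (metis subsetD)
  then show ?thesis
    using triangle_affine_eqI[OF assms(1) _ assms(5)] u[OF assms(5)] v[OF assms(5)] by metis
qed

lemma triangle_interpolation:
  assumes "2 simplex e"
  obtains a c where "\<And>p. p \<in> vertices e \<Longrightarrow> a \<bullet> p + c = w p"
proof -
  obtain p :: "nat \<Rightarrow> point" where p: "vertices e = p ` {1,2,3}" using triangle_facts(5)[OF assms] by blast
  obtain a c where ac: "\<And>k. k \<in> {1,2,3} \<Longrightarrow> a \<bullet> p k + c = w (p k)"
  proof (rule affine_interpolation[of p "\<lambda>k. w (p k)"])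
    fix a c assume "\<And>k. k \<in> {1,2,3} \<Longrightarrow> a \<bullet> p k + c = 0"
    then have "a \<bullet> x + c = 0" if "x \<in> e" for x
      using that triangle_facts(4)[OF assms] p affine_zero_on_convex_hull[of "vertices e" a c x] by auto
    then show "a = 0 \<and> c = 0" using affine_zero_on_interior triangle_facts(3)[OF assms] by blast
  qed blast
  have "a \<bullet> q + c = w q" if "q \<in> vertices e" for q using that ac unfolding p by blast
  then show ?thesis by (rule that)
qed

section \<open>Conforming meshes and nodal interpolation\<close>

locale mesh =
  fixes T :: "point set set" and \<Omega> :: "point set"
  assumes triangulation: "triangulation_of T \<Omega>"
begin

lemma finite_elements: "finite T"
  using triangulation by (simp add: triangulation_of_def triangulation_def)

lemma element_simplex: "e \<in> T \<Longrightarrow> 2 simplex e"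
  using triangulation by (simp add: triangulation_of_def)

lemma cover: "\<Union>T = closure \<Omega>"
  using triangulation by (simp add: triangulation_of_def)

lemma face: "e \<in> T \<Longrightarrow> e' \<in> T \<Longrightarrow> e \<inter> e' face_of e"
  using triangulation by (simp add: triangulation_of_def triangulation_def)

lemma finite_nodes: "finite (nodes T)"
  using finite_elements finite_vertices element_simplex by (auto simp: nodes_def)

text \<open>By Krein-Milman the common face is the convex hull of its extreme points. These are
  vertices of both elements, where both affine functions take the value of w, so the two agree on
  the whole face.\<close>

lemma conforming:
  assumes "e \<in> T" "e' \<in> T" "x \<in> e" "x \<in> e'"
    and "\<And>p. p \<in> vertices e \<Longrightarrow> a \<bullet> p + c = w p" "\<And>p. p \<in> vertices e' \<Longrightarrow> a' \<bullet> p + c' = w p"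
  shows "a \<bullet> x + c = a' \<bullet> x + c'"
proof -
  let ?F = "e \<inter> e'"
  have "?F face_of e" "?F face_of e'" using face[OF assms(1,2)] face[OF assms(2,1)] by (simp_all add: Int_commute)
  then have v: "p \<in> vertices e" "p \<in> vertices e'" if "p extreme_point_of ?F" for p
    using that extreme_point_of_face unfolding vertices_def by blast+
  have "compact ?F" "convex ?F"
    using triangle_facts(1,2)[OF element_simplex] assms(1,2) by (auto intro: compact_Int convex_Int)
  then have "x \<in> convex hull {p. p extreme_point_of ?F}"
    using Krein_Milman_Minkowski assms(3,4) by blast
  then have "(a - a') \<bullet> x + (c - c') = 0"
  proof (rule affine_zero_on_convex_hull[rotated])
    fix p assume "p \<in> {p. p extreme_point_of ?F}"
    then show "(a - a') \<bullet> p + (c - c') = 0"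
      using assms(5)[of p] assms(6)[of p] v by (simp add: inner_diff_left)
  qed
  then show ?thesis by (simp add: inner_diff_left)
qed

definition is_interpolant :: "scalar_fn \<Rightarrow> scalar_fn \<Rightarrow> bool" where
  "is_interpolant w v \<longleftrightarrow> (\<forall>e\<in>T. v \<in> P1 e) \<and> (\<forall>p\<in>nodes T. v p = w p) \<and> (\<forall>x. x \<notin> \<Union>T \<longrightarrow> v x = 0)"

lemma is_interpolant_unique:
  assumes "is_interpolant w v" "is_interpolant w v'" shows "v = v'"
proof
  fix x
  show "v x = v' x"
  proof (cases "x \<in> \<Union>T")
    case True
    then obtain e where e: "e \<in> T" "x \<in> e" by blast
    show ?thesis
    proof (rule P1_eqI[OF element_simplex _ _ _ e(2)])
      show "v p = v' p" if "p \<in> vertices e" for p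
      proof -
        have "p \<in> nodes T" using that e(1) by (auto simp: nodes_def)
        then show ?thesis using assms by (metis is_interpolant_def)
      qed
    qed (use assms e in \<open>auto simp: is_interpolant_def\<close>)
  qed (use assms in \<open>auto simp: is_interpolant_def\<close>)
qed

lemma is_interpolant_exists: "\<exists>v. is_interpolant w v"
proof -
  have "\<forall>e\<in>T. \<exists>a c. \<forall>p\<in>vertices e. a \<bullet> p + c = w p"
    using triangle_interpolation[OF element_simplex] by metis
  then obtain a c where ac: "\<And>e p. e \<in> T \<Longrightarrow> p \<in> vertices e \<Longrightarrow> a e \<bullet> p + c e = w p" by metis
  \<comment> \<open>An arbitrary element containing x; \<open>conforming\<close> makes the glued
    value independent of this choice.\<close>
  define E where "E x = (SOME e. e \<in> T \<and> x \<in> e)" for x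
  define v where "v x = (if x \<in> \<Union>T then a (E x) \<bullet> x + c (E x) else 0)" for x
  have v: "v x = a e \<bullet> x + c e" if "e \<in> T" "x \<in> e" for e x
  proof -
    have "E x \<in> T \<and> x \<in> E x" unfolding E_def using that by (intro someI) auto
    then show ?thesis
      using that conforming[of "E x" e x "a (E x)" "c (E x)" w "a e" "c e"] ac by (auto simp: v_def)
  qed
  have "is_interpolant w v"
    unfolding is_interpolant_def
  proof (intro conjI ballI allI impI)
    show "v \<in> P1 e" if "e \<in> T" for e using v[OF that] unfolding P1_def by blast
    show "v p = w p" if p: "p \<in> nodes T" for p
    proof -
      obtain e where "e \<in> T" "p \<in> vertices e" using p unfolding nodes_def by blast
      then show ?thesis using v[of e p] ac vertices_subset by fastforce
    qed
  qed (auto simp: v_def)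
  then show ?thesis by blast
qed

lemma nodal_interpolant: "is_interpolant w (nodal_interpolant T w)"
proof -
  have "nodal_interpolant T w = (THE v. is_interpolant w v)"
    by (simp add: nodal_interpolant_def is_interpolant_def)
  moreover have "\<exists>!v. is_interpolant w v"
    using is_interpolant_exists is_interpolant_unique by blast
  ultimately show ?thesis using theI' by metis
qed

text \<open>A combination of interpolants has the properties that characterise the interpolant of
  the combination, so uniqueness identifies the two.\<close>

lemma linear_nodal_interpolant: "linear (nodal_interpolant T)"
proof (rule linearI)
  fix u v :: scalar_fn and r :: real
  have "is_interpolant (u + v) (nodal_interpolant T u + nodal_interpolant T v)"
    using nodal_interpolant[of u] nodal_interpolant[of v] subspace_P1
    by (auto simp: is_interpolant_def subspace_add)
  then show "nodal_interpolant T (u + v) = nodal_interpolant T u + nodal_interpolant T v"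
    using nodal_interpolant is_interpolant_unique by blast
  have "is_interpolant (r *\<^sub>R u) (r *\<^sub>R nodal_interpolant T u)"
    using nodal_interpolant[of u] subspace_P1
    by (auto simp: is_interpolant_def intro!: subspace_scale)
  then show "nodal_interpolant T (r *\<^sub>R u) = r *\<^sub>R nodal_interpolant T u"
    using nodal_interpolant is_interpolant_unique by blast
qed

text \<open>A function of the space is determined by its values at the nodes of T: it vanishes off
  U, and on an element it is fixed by the vertex values. Affinity is guaranteed only on elements
  inside the closure of U, so the assumption asks that such elements cover U.\<close>

lemma separated_fe_space:
  assumes "\<And>x. x \<in> U \<Longrightarrow> \<exists>e\<in>T. x \<in> e \<and> e \<subseteq> closure U"
  shows "separated (fe_space T U)"
proof -
  let ?P = "(\<lambda>p (u :: scalar_fn). u p) ` nodes T"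
  have "u = 0" if u: "u \<in> fe_space T U" and z: "\<And>p. p \<in> nodes T \<Longrightarrow> u p = 0" for u
  proof
    fix x
    show "u x = 0 x"
    proof (cases "x \<in> U")
      case True
      then obtain e where e: "e \<in> T" "x \<in> e" "e \<subseteq> closure U" using assms by blast
      show ?thesis
      proof (rule P1_eqI[OF element_simplex[OF e(1)] _ subspace_0[OF subspace_P1] _ e(2)])
        show "u \<in> P1 e" using u e by (simp add: fe_space_def)
        show "u p = 0 p" if "p \<in> vertices e" for p
          using z[of p] that e(1) by (auto simp: nodes_def)
      qed
    qed (use u in \<open>auto simp: fe_space_def\<close>)
  qed
  moreover have "linear (\<lambda>u :: scalar_fn. u p)" for p by (rule linearI) auto
  ultimately show ?thesis
    unfolding separated_def using finite_nodes by (intro exI[of _ ?P]) auto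
qed

end

section \<open>Bilinearity of the stiffness forms\<close>

lemma set_integrable_continuous_bounded:
  fixes f :: "point \<Rightarrow> real"
  assumes "continuous_on UNIV f" "S \<in> sets lebesgue" "bounded S"
  shows "set_integrable lebesgue S f"
proof -
  obtain a b where "S \<subseteq> cbox a b" using assms(3) bounded_subset_cbox_symmetric by blast
  moreover have "set_integrable lebesgue (cbox a b) f"
    using absolutely_integrable_continuous[of a b f] continuous_on_subset[OF assms(1)] by blast
  ultimately show ?thesis using set_integrable_subset assms(2) by blast
qed

text \<open>Additivity of the integral requires integrability. Expanding the inner product of two
  piecewise fields gives a double sum over the intersections of pieces, each term continuous on a
  bounded measurable set; overlapping pieces are covered as well. The smoothed fields are such sums
  by definition, while \<open>grad u\<close> is one only off the element boundaries, hence the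
  almost-everywhere hypothesis.\<close>

lemma symmetric_form_piecewise:
  fixes F :: "scalar_fn \<Rightarrow> point \<Rightarrow> point" and P :: "'i \<Rightarrow> scalar_fn \<Rightarrow> point \<Rightarrow> point"
  assumes V: "subspace V" and \<Omega>: "\<Omega> \<in> sets lebesgue" "bounded \<Omega>"
    and D: "\<And>i. i \<in> I \<Longrightarrow> D i \<in> sets lebesgue"
    and cont: "\<And>i u. i \<in> I \<Longrightarrow> u \<in> V \<Longrightarrow> continuous_on UNIV (P i u)"
    and lin: "\<And>i. i \<in> I \<Longrightarrow> linear_on V (P i)"
    and F: "\<And>u. u \<in> V \<Longrightarrow> AE x in lebesgue. x \<in> \<Omega> \<longrightarrow>
      F u x = (\<Sum>i\<in>I. indicator (D i) x *\<^sub>R P i u x)"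
  shows "symmetric_form V (\<lambda>u v. LINT x:\<Omega>|lebesgue. F u x \<bullet> F v x)"
proof -
  define S where "S u x = (\<Sum>i\<in>I. indicator (D i) x *\<^sub>R P i u x)" for u x
  have int: "integrable lebesgue (\<lambda>x. indicator \<Omega> x *\<^sub>R (S u x \<bullet> S v x))" if "u \<in> V" "v \<in> V" for u v
  proof -
    have "(\<lambda>x. indicator \<Omega> x *\<^sub>R (S u x \<bullet> S v x)) =
        (\<lambda>x. \<Sum>i\<in>I. \<Sum>j\<in>I. indicator (\<Omega> \<inter> D i \<inter> D j) x *\<^sub>R (P i u x \<bullet> P j v x))"
    proof
      fix x
      have "S u x \<bullet> S v x = (\<Sum>i\<in>I. \<Sum>j\<in>I. (indicator (D i) x *\<^sub>R P i u x) \<bullet> (indicator (D j) x *\<^sub>R P j v x))"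
        unfolding S_def inner_sum_left by (simp only: inner_sum_right)
      then show "indicator \<Omega> x *\<^sub>R (S u x \<bullet> S v x) =
          (\<Sum>i\<in>I. \<Sum>j\<in>I. indicator (\<Omega> \<inter> D i \<inter> D j) x *\<^sub>R (P i u x \<bullet> P j v x))"
        by (simp add: sum_distrib_left indicator_inter_arith mult_ac)
    qed
    moreover have "integrable lebesgue (\<lambda>x. indicator (\<Omega> \<inter> D i \<inter> D j) x *\<^sub>R (P i u x \<bullet> P j v x))"
      if "i \<in> I" "j \<in> I" for i j
    proof -
      have "continuous_on UNIV (\<lambda>x. P i u x \<bullet> P j v x)"
        using cont that \<open>u \<in> V\<close> \<open>v \<in> V\<close> by (intro continuous_intros) auto
      moreover have "bounded (\<Omega> \<inter> D i \<inter> D j)" using \<Omega>(2) bounded_subset by (metis Int_assoc inf_le1)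
      ultimately show ?thesis
        using set_integrable_continuous_bounded[of _ "\<Omega> \<inter> D i \<inter> D j"] D \<Omega> that unfolding set_integrable_def by blast
    qed
    ultimately show ?thesis by simp
  qed
  have eq: "(LINT x:\<Omega>|lebesgue. F u x \<bullet> F v x) = (LINT x|lebesgue. indicator \<Omega> x *\<^sub>R (S u x \<bullet> S v x))"
    if "u \<in> V" "v \<in> V" for u v
  proof -
    have ae: "AE x in lebesgue. indicator \<Omega> x *\<^sub>R (S u x \<bullet> S v x) = indicator \<Omega> x *\<^sub>R (F u x \<bullet> F v x)"
      using F[OF that(1)] F[OF that(2)] by eventually_elim (auto simp: S_def indicator_def)
    have "(\<lambda>x. indicator \<Omega> x *\<^sub>R (S u x \<bullet> S v x)) \<in> borel_measurable lebesgue"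
      using int[OF that] by blast
    \<comment> \<open>Measurability of the integrand built from F is inherited from its
      almost-everywhere representative, by completeness of Lebesgue measure.\<close>
    with ae show ?thesis
      unfolding set_lebesgue_integral_def
      by (intro integral_cong_AE[symmetric] borel_measurable_AE[OF _ ae]) auto
  qed
  have S: "S (u + v) x = S u x + S v x" "S (r *\<^sub>R u) x = r *\<^sub>R S u x" if "u \<in> V" "v \<in> V" for u v r x
    using lin that by (simp_all add: S_def linear_on_def scaleR_add_right sum.distrib scaleR_sum_right mult.commute)
  show ?thesis
  proof
    fix u v w and r :: real
    assume u: "u \<in> V"
    { assume v: "v \<in> V"
      show "(LINT x:\<Omega>|lebesgue. F u x \<bullet> F v x) = (LINT x:\<Omega>|lebesgue. F v x \<bullet> F u x)"
        by (simp add: inner_commute)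
      assume w: "w \<in> V"
      have "u + v \<in> V" using u v V by (simp add: subspace_add)
      then show "(LINT x:\<Omega>|lebesgue. F (u + v) x \<bullet> F w x) =
          (LINT x:\<Omega>|lebesgue. F u x \<bullet> F w x) + (LINT x:\<Omega>|lebesgue. F v x \<bullet> F w x)"
        using u v w int by (simp add: eq S inner_add_left distrib_left) }
    assume w: "w \<in> V"
    have "r *\<^sub>R u \<in> V" using u V by (simp add: subspace_scale)
    then show "(LINT x:\<Omega>|lebesgue. F (r *\<^sub>R u) x \<bullet> F w x) = r * (LINT x:\<Omega>|lebesgue. F u x \<bullet> F w x)"
      using u w int by (simp add: eq S mult.left_commute)
  qed (fact V)
qed

lemma GDERIV_affine_on_interior:
  fixes u :: scalar_fn
  assumes "\<And>x. x \<in> e \<Longrightarrow> u x = a \<bullet> x + c" "x \<in> interior e"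
  shows "GDERIV u x :> a"
proof -
  have "((\<lambda>x. a \<bullet> x + c) has_derivative (\<lambda>h. a \<bullet> h)) (at x)"
    by (auto intro!: derivative_eq_intros)
  then have "(u has_derivative (\<lambda>h. a \<bullet> h)) (at x)"
    by (rule has_derivative_transform_within_open[OF _ open_interior assms(2)])
      (metis assms(1) interior_subset subsetD)
  then show ?thesis by (simp add: gderiv_def inner_commute)
qed

lemma element_grad_eq:
  assumes "\<And>x. x \<in> e \<Longrightarrow> u x = a \<bullet> x + c" "interior e \<noteq> {}"
  shows "element_grad u e = a"
  unfolding element_grad_def
proof (rule the_equality)
  show "\<forall>x\<in>interior e. GDERIV u x :> a" using GDERIV_affine_on_interior[OF assms(1)] by blast
  then show "g = a" if "\<forall>x\<in>interior e. GDERIV u x :> g" for g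
    using that assms(2) GDERIV_unique by blast
qed

lemma grad_eq_element_grad:
  assumes "u \<in> P1 e" "x \<in> interior e"
  shows "grad u x = element_grad u e"
proof -
  obtain a c where ac: "\<And>x. x \<in> e \<Longrightarrow> u x = a \<bullet> x + c" using assms(1) unfolding P1_def by blast
  moreover have "interior e \<noteq> {}" using assms(2) by blast
  ultimately have "element_grad u e = a" by (rule element_grad_eq)
  then show ?thesis using grad_eq[OF GDERIV_affine_on_interior[OF ac assms(2)]] by simp
qed

lemma linear_on_element_grad:
  assumes "interior e \<noteq> {}" shows "linear_on (P1 e) (\<lambda>u. element_grad u e)"
  unfolding linear_on_def
proof (intro conjI ballI allI)
  fix u v and r :: real
  assume u: "u \<in> P1 e"
  obtain a c where a: "\<And>x. x \<in> e \<Longrightarrow> u x = a \<bullet> x + c" using u unfolding P1_def by blast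
  have eu: "element_grad u e = a" using a assms by (rule element_grad_eq)
  { assume v: "v \<in> P1 e"
    obtain a' c' where a': "\<And>x. x \<in> e \<Longrightarrow> v x = a' \<bullet> x + c'" using v unfolding P1_def by blast
    have "element_grad (u + v) e = a + a'"
      by (rule element_grad_eq[of e _ _ "c + c'"]) (simp_all add: a a' assms inner_add_left)
    then show "element_grad (u + v) e = element_grad u e + element_grad v e"
      using eu element_grad_eq[OF a' assms] by simp }
  have "element_grad (r *\<^sub>R u) e = r *\<^sub>R a"
    by (rule element_grad_eq[of e _ _ "r * c"]) (simp_all add: a assms distrib_left)
  then show "element_grad (r *\<^sub>R u) e = r *\<^sub>R element_grad u e" using eu by simp
qed

lemma linear_on_subset: "linear_on Y f \<Longrightarrow> X \<subseteq> Y \<Longrightarrow> linear_on X f"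
  unfolding linear_on_def by blast

text \<open>The rank-one matrix built from a brings the square into the shape of the quadratics for
  which \<open>gauss_points\<close> demands exactness.\<close>

lemma affine_power2_eq_quadratic:
  fixes a x :: point
  shows "(a \<bullet> x + c)\<^sup>2 = x \<bullet> ((\<chi> i j. a $ i * a $ j) *v x) + (2 * c) *\<^sub>R a \<bullet> x + c\<^sup>2"
proof -
  have "(\<chi> i j. a $ i * a $ j) *v x = (a \<bullet> x) *\<^sub>R a"
    by (simp add: vec_eq_iff matrix_vector_mult_def inner_vec_def sum_distrib_left sum_distrib_right mult_ac)
  then show ?thesis by (simp add: power2_eq_square inner_commute algebra_simps)
qed

text \<open>The square of an affine function vanishing at the three points is integrated to \<open>0\<close>.\<close>

lemma gauss_points_unisolvent:
  assumes "gauss_points T G" "e \<in> T" "2 simplex e"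
    and zero: "\<And>k. k \<in> {1,2,3} \<Longrightarrow> a \<bullet> G e k + c = 0"
  shows "a = 0 \<and> c = 0"
proof -
  let ?q = "\<lambda>x. (a \<bullet> x + c)\<^sup>2"
  have "(LINT x:e|lebesgue. ?q x) = area e / 3 * (\<Sum>k\<in>{1,2,3}. ?q (G e k))"
    unfolding affine_power2_eq_quadratic
    using assms(1,2) unfolding gauss_points_def Let_def by blast
  also have "\<dots> = 0" using zero by simp
  finally have "(LINT x|lebesgue. indicator e x *\<^sub>R ?q x) = 0" by (simp add: set_lebesgue_integral_def)
  moreover have "set_integrable lebesgue e ?q"
    using triangle_facts(1)[OF assms(3)]
    by (intro set_integrable_continuous_bounded continuous_intros) (auto simp: compact_imp_bounded compact_imp_closed)
  ultimately have "AE x in lebesgue. indicator e x *\<^sub>R ?q x = 0"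
    unfolding set_integrable_def by (subst (asm) integral_nonneg_eq_0_iff_AE) auto
  then have "AE x in lebesgue. \<not> (x \<in> interior e \<and> a \<bullet> x + c \<noteq> 0)"
    by eventually_elim (use interior_subset in \<open>fastforce simp: indicator_def split: if_splits\<close>)
  then have "negligible {x. x \<in> interior e \<and> a \<bullet> x + c \<noteq> 0}"
    by (simp add: AE_iff_null_sets negligible_iff_null_sets eventually_ae_filter null_sets_completion_subset)
  \<comment> \<open>An open negligible set is empty, which upgrades vanishing almost everywhere to
    vanishing on the whole interior.\<close>
  moreover have "open {x. x \<in> interior e \<and> a \<bullet> x + c \<noteq> 0}"
    by (intro open_Collect_conj open_Collect_neq continuous_intros) auto
  ultimately have "{x. x \<in> interior e \<and> a \<bullet> x + c \<noteq> 0} = {}" using open_not_negligible by blast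
  then show ?thesis
    using triangle_facts(3)[OF assms(3)] by (intro affine_zero_on_interior[of "interior e"]) auto
qed

lemma matrix_vector_mult_component_inner: "(B *v x) $ i = B $ i \<bullet> x"
  by (simp add: matrix_vector_mult_def inner_vec_def)

text \<open>Everything decouples into components: row i of the matrix together with entry i of the
  shift is the scalar affine interpolant of the i-th components of the data.\<close>

lemma linear_vector_polynomial_interpolation:
  fixes p :: "nat \<Rightarrow> point" and y :: "nat \<Rightarrow> point"
  assumes unisolvent: "\<And>a c. (\<And>k. k \<in> {1,2,3} \<Longrightarrow> a \<bullet> p k + c = 0) \<Longrightarrow> a = 0 \<and> c = 0"
  shows "\<exists>!f. linear_vector_polynomial f \<and> (\<forall>k\<in>{1,2,3}. f (p k) = y k)"
proof (rule ex_ex1I)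
  have "\<forall>i. \<exists>a c. \<forall>k\<in>{1,2,3}. a \<bullet> p k + c = y k $ i"
  proof
    fix i
    obtain a c where "\<And>k. k \<in> {1,2,3} \<Longrightarrow> a \<bullet> p k + c = y k $ i"
      using affine_interpolation[OF unisolvent, of p "\<lambda>k. y k $ i"] by blast
    then show "\<exists>a c. \<forall>k\<in>{1,2,3}. a \<bullet> p k + c = y k $ i" by blast
  qed
  then obtain a c where ac: "\<And>i k. k \<in> {1,2,3} \<Longrightarrow> a i \<bullet> p k + c i = y k $ i" by metis
  let ?f = "\<lambda>x. (\<chi> i. a i) *v x + (\<chi> i. c i) :: point"
  have "?f (p k) = y k" if "k \<in> {1,2,3}" for k
    using ac[OF that] by (simp add: vec_eq_iff matrix_vector_mult_component_inner)
  then show "\<exists>f. linear_vector_polynomial f \<and> (\<forall>k\<in>{1,2,3}. f (p k) = y k)"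
    unfolding linear_vector_polynomial_def by (intro exI[of _ ?f]) blast
next
  fix f g
  assume f: "linear_vector_polynomial f \<and> (\<forall>k\<in>{1,2,3}. f (p k) = y k)"
    and g: "linear_vector_polynomial g \<and> (\<forall>k\<in>{1,2,3}. g (p k) = y k)"
  obtain B b B' b' where B: "f = (\<lambda>x. B *v x + b)" "g = (\<lambda>x. B' *v x + b')"
    using f g unfolding linear_vector_polynomial_def by blast
  have "B $ i - B' $ i = 0 \<and> b $ i - b' $ i = 0" for i
  proof (rule unisolvent)
    fix k :: nat assume "k \<in> {1,2,3}"
    then have "f (p k) $ i = g (p k) $ i" using f g by auto
    then show "(B $ i - B' $ i) \<bullet> p k + (b $ i - b' $ i) = 0"
      by (simp add: B matrix_vector_mult_component_inner inner_diff_left)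
  qed
  then have "B = B'" "b = b'" by (simp_all add: vec_eq_iff)
  then show "f = g" by (simp add: B)
qed

section \<open>The three stiffness forms on a mesh\<close>

context mesh
begin

lemma fe_space_P1: "u \<in> fe_space T \<Omega> \<Longrightarrow> e \<in> T \<Longrightarrow> u \<in> P1 e"
  using cover Union_upper[of e T] by (simp add: fe_space_def)

lemma interior_nonempty: "e \<in> T \<Longrightarrow> interior e \<noteq> {}"
  using triangle_facts(3) element_simplex by blast

text \<open>A face that meets the interior of a convex set is the whole set, so the intersection of
  the two elements equals each of them.\<close>

lemma interiors_disjoint:
  assumes "e \<in> T" "e' \<in> T" "x \<in> interior e" "x \<in> interior e'"
  shows "e = e'"
proof -
  have "e \<inter> e' = e" if "e \<in> T" "e' \<in> T" "x \<in> interior e" "x \<in> interior e'" for e e'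
    using face_of_disjoint_interior[OF face[OF that(1,2)]] that(3,4) interior_subset by blast
  then show ?thesis using assms by (metis Int_commute)
qed

lemma AE_in_element_interior: "AE x in lebesgue. x \<in> \<Omega> \<longrightarrow> (\<exists>e\<in>T. x \<in> interior e)"
proof -
  have "negligible (\<Union>e\<in>T. frontier e)"
    using finite_elements triangle_facts(2)[OF element_simplex]
    by (intro negligible_Union) (auto intro: negligible_convex_frontier)
  then have "AE x in lebesgue. x \<notin> (\<Union>e\<in>T. frontier e)"
    by (intro AE_not_in) (simp add: negligible_iff_null_sets)
  then show ?thesis
  proof eventually_elim
    case (elim x)
    show ?case
    proof
      assume "x \<in> \<Omega>"
      then obtain e where "e \<in> T" "x \<in> e" using cover closure_subset by blast
      moreover have "frontier e = e - interior e"
        using triangle_facts(1)[OF element_simplex[OF \<open>e \<in> T\<close>]]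
        by (simp add: frontier_def compact_imp_closed)
      ultimately show "\<exists>e\<in>T. x \<in> interior e" using elim by blast
    qed
  qed
qed

lemma linear_on_fe_element_grad: "e \<in> T \<Longrightarrow> linear_on (fe_space T \<Omega>) (\<lambda>u. element_grad u e)"
  using linear_on_subset[OF linear_on_element_grad[OF interior_nonempty]] fe_space_P1 by blast

lemma linear_on_smoothed_grad: "linear_on (fe_space T \<Omega>) (\<lambda>u. smoothed_grad T u f)"
proof -
  have "element_grad (u + v) e = element_grad u e + element_grad v e"
    "element_grad (r *\<^sub>R u) e = r *\<^sub>R element_grad u e"
    if "u \<in> fe_space T \<Omega>" "v \<in> fe_space T \<Omega>" "e \<in> T" for u v e r
    using linear_on_fe_element_grad that unfolding linear_on_def by blast+
  then show ?thesis
    by (simp add: linear_on_def smoothed_grad_def scaleR_add_right sum.distrib scaleR_sum_right mult_ac)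
qed

lemma symmetric_form_stiffness:
  assumes "open \<Omega>" "bounded \<Omega>"
  shows "symmetric_form (fe_space T \<Omega>) (stiffness \<Omega>)"
  unfolding stiffness_def[abs_def]
proof (rule symmetric_form_piecewise[where I = T and D = interior and P = "\<lambda>e u x. element_grad u e"])
  show "linear_on (fe_space T \<Omega>) (\<lambda>u x. element_grad u e)" if "e \<in> T" for e
    using linear_on_fe_element_grad[OF that] by (auto simp: linear_on_def fun_eq_iff)
  show "AE x in lebesgue. x \<in> \<Omega> \<longrightarrow> grad u x = (\<Sum>e\<in>T. indicator (interior e) x *\<^sub>R element_grad u e)"
    if u: "u \<in> fe_space T \<Omega>" for u
    using AE_in_element_interior
  proof eventually_elim
    case (elim x)
    show ?case
    proof
      assume "x \<in> \<Omega>"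
      then obtain d where d: "d \<in> T" "x \<in> interior d" using elim by blast
      have "(\<Sum>e\<in>T. indicator (interior e) x *\<^sub>R element_grad u e) =
          (\<Sum>e\<in>T. if e = d then element_grad u e else 0)"
        using d interiors_disjoint by (intro sum.cong) (auto simp: indicator_def)
      then show "grad u x = (\<Sum>e\<in>T. indicator (interior e) x *\<^sub>R element_grad u e)"
        using d finite_elements grad_eq_element_grad[OF fe_space_P1[OF u]] by simp
    qed
  qed
qed (use assms subspace_fe_space in auto)

lemma symmetric_form_stiffness_ES:
  assumes "open \<Omega>" "bounded \<Omega>"
  shows "symmetric_form (fe_space T \<Omega>) (stiffness_ES \<Omega> T)"
  unfolding stiffness_ES_def[abs_def]
proof (rule symmetric_form_piecewise[where I = "edges T" and D = "\<lambda>f. interior (smoothing_domain T f)"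
      and P = "\<lambda>f u x. smoothed_grad T u f"])
  show "linear_on (fe_space T \<Omega>) (\<lambda>u x. smoothed_grad T u f)" for f
    using linear_on_smoothed_grad by (auto simp: linear_on_def fun_eq_iff)
qed (use assms subspace_fe_space in \<open>auto simp: ES_grad_def\<close>)

text \<open>\<open>SSE_poly\<close> is a \<open>THE\<close>, meaningful because the Gauss points are
  unisolvent for affine functions. Linearity in u follows from uniqueness: the values prescribed at
  the Gauss points are linear in u, and combinations of linear vector polynomials are again such
  polynomials.\<close>

lemma symmetric_form_stiffness_SSE:
  assumes "open \<Omega>" "bounded \<Omega>" and G: "gauss_points T G"
  shows "symmetric_form (fe_space T \<Omega>) (stiffness_SSE \<Omega> T ed G)"
  unfolding stiffness_SSE_def[abs_def]
proof (rule symmetric_form_piecewise[where I = T and D = interior and P = "\<lambda>e u. SSE_poly T ed G u e"])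
  define y where "y e u k = (1/2) *\<^sub>R (smoothed_grad T u (ed e (if k = 1 then 3 else k - 1)) +
    smoothed_grad T u (ed e k))" for e u and k :: nat
  have ex1: "\<exists>!p. linear_vector_polynomial p \<and> (\<forall>k\<in>{1,2,3}. p (G e k) = y e u k)" if "e \<in> T" for e u
    using gauss_points_unisolvent[OF G that element_simplex[OF that]]
    by (rule linear_vector_polynomial_interpolation)
  have the: "SSE_poly T ed G u e = (THE p. linear_vector_polynomial p \<and> (\<forall>k\<in>{1,2,3}. p (G e k) = y e u k))"
    for u e by (simp add: SSE_poly_def y_def)
  have poly: "linear_vector_polynomial (SSE_poly T ed G u e)"
    "\<And>k. k \<in> {1,2,3} \<Longrightarrow> SSE_poly T ed G u e (G e k) = y e u k" if "e \<in> T" for e u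
    using theI'[OF ex1[OF that]] unfolding the by blast+
  have eqI: "SSE_poly T ed G u e = p"
    if "e \<in> T" "linear_vector_polynomial p" "\<And>k. k \<in> {1,2,3} \<Longrightarrow> p (G e k) = y e u k" for e u p
    unfolding the using ex1 that by (intro the1_equality) auto
  show "continuous_on UNIV (SSE_poly T ed G u e)" if "e \<in> T" for e u
    using poly(1)[OF that, of u] unfolding linear_vector_polynomial_def
    by (auto intro!: continuous_intros matrix_vector_mult_linear_continuous_on)
  show "linear_on (fe_space T \<Omega>) (\<lambda>u. SSE_poly T ed G u e)" if e: "e \<in> T" for e
    unfolding linear_on_def
  proof (intro conjI ballI allI)
    fix u v and r :: real
    assume u: "u \<in> fe_space T \<Omega>"
    obtain B b where B: "SSE_poly T ed G u e = (\<lambda>x. B *v x + b)"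
      using poly(1)[OF e, of u] unfolding linear_vector_polynomial_def by blast
    { assume v: "v \<in> fe_space T \<Omega>"
      obtain B' b' where B': "SSE_poly T ed G v e = (\<lambda>x. B' *v x + b')"
        using poly(1)[OF e, of v] unfolding linear_vector_polynomial_def by blast
      have sum: "SSE_poly T ed G u e + SSE_poly T ed G v e = (\<lambda>x. (B + B') *v x + (b + b'))"
        by (simp add: B B' fun_eq_iff matrix_vector_mult_add_rdistrib)
      show "SSE_poly T ed G (u + v) e = SSE_poly T ed G u e + SSE_poly T ed G v e"
      proof (rule eqI[OF e])
        show "linear_vector_polynomial (SSE_poly T ed G u e + SSE_poly T ed G v e)"
          unfolding linear_vector_polynomial_def sum by blast
        have "y e (u + v) k = y e u k + y e v k" for k
          using u v linear_on_smoothed_grad by (simp add: y_def linear_on_def scaleR_add_right)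
        then show "(SSE_poly T ed G u e + SSE_poly T ed G v e) (G e k) = y e (u + v) k"
          if "k \<in> {1,2,3}" for k using poly(2)[OF e that] by (simp only: plus_fun_apply)
      qed }
    have scale: "r *\<^sub>R SSE_poly T ed G u e = (\<lambda>x. (r *\<^sub>R B) *v x + r *\<^sub>R b)"
      by (simp add: B fun_eq_iff scaleR_matrix_vector_assoc scaleR_add_right)
    show "SSE_poly T ed G (r *\<^sub>R u) e = r *\<^sub>R SSE_poly T ed G u e"
    proof (rule eqI[OF e])
      show "linear_vector_polynomial (r *\<^sub>R SSE_poly T ed G u e)"
        unfolding linear_vector_polynomial_def scale by blast
      have "y e (r *\<^sub>R u) k = r *\<^sub>R y e u k" for k
        using u linear_on_smoothed_grad by (simp add: y_def linear_on_def scaleR_add_right)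
      then show "(r *\<^sub>R SSE_poly T ed G u e) (G e k) = y e (r *\<^sub>R u) k"
        if "k \<in> {1,2,3}" for k using poly(2)[OF e that] by (simp only: scaleR_fun_apply)
    qed
  qed
qed (use assms subspace_fe_space in \<open>auto simp: SSE_grad_def\<close>)

end

section \<open>The overlapping two-level method as a Schwarz method\<close>

lemma linear_extension_by_zero: "linear (extension_by_zero U)"
  by (rule linearI) (auto simp: extension_by_zero_def fun_eq_iff)

lemma schwarz_method_two_level:
  assumes Th: "triangulation_of Th \<Omega>" and TH: "triangulation_of TH \<Omega>"
    and dd: "overlapping_decomposition \<Omega> Th TH N m \<delta> \<Omega>s \<Omega>s'"
    and A: "symmetric_form (fe_space Th \<Omega>) A" and B: "symmetric_form (fe_space Th \<Omega>) B"
    and M: "M = two_level_schwarz \<Omega> Th TH N \<Omega>s' B"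
    and adm: "schwarz_admissible (fe_space Th \<Omega>) A M"
  shows "schwarz_method (fe_space Th \<Omega>) A M"
proof -
  interpret h: mesh Th \<Omega> by unfold_locales fact
  interpret H: mesh TH \<Omega> by unfold_locales fact
  have M_simps: "indices M = {0..N}" "local_space M = dd_space \<Omega> Th TH \<Omega>s'"
    "prolong M = dd_prolong Th \<Omega>s'"
    "local_form M = (\<lambda>j u v. B (dd_prolong Th \<Omega>s' j u) (dd_prolong Th \<Omega>s' j v))"
    by (simp_all add: M two_level_schwarz_def)
  have sub: "subspace (local_space M j)" for j
    by (simp add: M_simps dd_space_def subspace_fe_space)
  have lin: "linear (prolong M j)" for j
    using linear_extension_by_zero h.linear_nodal_interpolant by (auto simp: M_simps dd_prolong_def)
  then have lin_on: "linear_on (local_space M j) (prolong M j)" for j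
    by (auto simp: linear_on_def linear_add linear_scale)
  have cover: "\<exists>e\<in>T. x \<in> e \<and> e \<subseteq> closure \<Omega>" if "x \<in> \<Omega>" "mesh T \<Omega>" for x T
  proof -
    interpret mesh T \<Omega> by fact
    have "x \<in> \<Union>T" using that(1) closure_subset[of \<Omega>] cover by auto
    then obtain e where "e \<in> T" "x \<in> e" by blast
    then show ?thesis using Union_upper[of e T] cover by auto
  qed
  have sep0: "separated (fe_space T \<Omega>)" if "mesh T \<Omega>" for T
    using mesh.separated_fe_space[OF that] cover[OF _ that] by blast
  have "separated (fe_space Th (\<Omega>s' j))" if j: "j \<in> {1..N}" for j
  proof (rule h.separated_fe_space)
    fix x assume x: "x \<in> \<Omega>s' j"
    obtain E where E: "E \<subseteq> Th" "\<Omega>s' j = interior (\<Union>E)"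
      using dd[unfolded overlapping_decomposition_def, THEN conjunct2, THEN conjunct2, rule_format, OF j]
      by metis
    have "x \<in> \<Union>E" using x interior_subset[of "\<Union>E"] unfolding E(2) by blast
    then obtain e where e: "e \<in> E" "x \<in> e" by blast
    \<comment> \<open>The enlarged subdomain is the interior of a union of elements, so it contains
      the interior of e, and its closure contains e.\<close>
    have "e \<subseteq> closure (interior e)" using triangle_facts(6)[OF h.element_simplex] e(1) E(1) by blast
    also have "\<dots> \<subseteq> closure (\<Omega>s' j)" unfolding E using e by (intro closure_mono interior_mono) auto
    finally show "\<exists>e\<in>Th. x \<in> e \<and> e \<subseteq> closure (\<Omega>s' j)" using e E(1) by blast
  qed
  then have sep: "separated (local_space M j)" if "j \<in> indices M" for j
    using that sep0[OF H.mesh_axioms] by (auto simp: M_simps dd_space_def)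
  have into: "prolong M j u \<in> fe_space Th \<Omega>" if "j \<in> indices M" "u \<in> local_space M j" for j u
  proof -
    \<comment> \<open>A family concentrated at j assembles to the prolongation of u, and
      admissibility puts every assembled function into V. Membership in \<open>H1_0\<close> of
      interpolants and zero extensions is thus obtained without analysis.\<close>
    let ?w = "\<lambda>i. if i = j then u else 0"
    have "?w \<in> local_families M" using that subspace_0[OF sub] by (auto simp: local_families_def)
    then have "assemble M ?w \<in> fe_space Th \<Omega>" using adm unfolding schwarz_admissible_def by blast
    moreover have "assemble M ?w = (\<Sum>i\<in>indices M. if i = j then prolong M j u else 0)"
      unfolding assemble_def fun_eq_iff sum_fun_apply using linear_0[OF lin] by (auto intro!: sum.cong)
    ultimately show ?thesis using that by (simp add: M_simps)
  qed
  show ?thesis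
  proof (rule schwarz_method.intro)
    show "symmetric_form (local_space M j) (local_form M j)" if "j \<in> indices M" for j
      using symmetric_form.pullback[OF B sub lin_on] into[OF that] by (auto simp: M_simps)
  qed (use M_simps sep lin_on into A sep0[OF h.mesh_axioms] adm in auto)
qed

theorem theorem4p3:
  fixes \<Omega> :: "point set" and Th TH :: "point set set" and N m :: nat and c \<delta> :: real
    and \<Omega>s \<Omega>s' :: "nat \<Rightarrow> point set" and K Kbar :: form
    and V :: "scalar_fn set" and M Mbar :: schwarz
  assumes "polygonal_domain \<Omega>" and "bounded \<Omega>"
    and "triangulation_of Th \<Omega>" and "c > 0" and "quasi_uniform c Th"
    and "triangulation_of TH \<Omega>"
    and "overlapping_decomposition \<Omega> Th TH N m \<delta> \<Omega>s \<Omega>s'"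
    and "V = fe_space Th \<Omega>"
    and "K = stiffness \<Omega>"
    and "Kbar = stiffness_ES \<Omega> Th \<or>
         (\<exists>ed G. edge_numbering Th ed \<and> gauss_points Th G \<and> Kbar = stiffness_SSE \<Omega> Th ed G)"
    and "M = two_level_schwarz \<Omega> Th TH N \<Omega>s' K"
    and "Mbar = two_level_schwarz \<Omega> Th TH N \<Omega>s' Kbar"
    and "schwarz_admissible V Kbar M"
    and "schwarz_admissible V Kbar Mbar"
  shows "kappa_ASM V Kbar Mbar \<le> kappa_ASM V Kbar M"
proof -
  interpret h: mesh Th \<Omega> by unfold_locales fact
  have "open \<Omega>" using assms(1) by (simp add: polygonal_domain_def)
  then have K: "symmetric_form V K" and Kbar: "symmetric_form V Kbar"
    using assms(2,8-10) h.symmetric_form_stiffness h.symmetric_form_stiffness_ES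
      h.symmetric_form_stiffness_SSE by auto
  have methods: "schwarz_method V Kbar M" "schwarz_method V Kbar Mbar"
    using schwarz_method_two_level[OF assms(3,6,7)] K Kbar assms(8,11-14) by blast+
  have K0: "K 0 0 = 0"
    using symmetric_form.zero_left[OF K] subspace_0[OF symmetric_form.subspace[OF K]] by blast
  show ?thesis
    by (rule kappa_ASM_exact_solvers_le[where B = K, OF methods _ _ _ _ _ K0])
      (simp_all add: assms(11,12) two_level_schwarz_def)
qed

end
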